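(* Let $A,C\in\mathcal{B}(\mathcal{H})$ be commuting operators on a complex Hilbert space $\mathcal{H}$ such that $A$ is positive and invertible, $\|C\|\le1$, and $I+A(A-2I)C^*C$ is invertible. Put $B=(I+A(A-2I)C^*C)^{-1/2}$, $D=(I-C^*C)^{1/2}$, $D_*=(I-CC^* )^{1/2}$ and $T=ABDC$. Let $\mathcal{K}=\mathcal{H}^{\oplus3}\oplus\ell^2(\mathcal{H})$, with $\mathcal{H}$ identified with the first summand of $\mathcal{H}^{\oplus 3}$, and let $V$ on $\mathcal{K}$ be defined by $$V=\left[\begin{array}{ccc|cccc} BDC & BDD_* & 0 & 0 & 0 & 0 & \cdots \\ (A-I)CBC & (A-I)CBD_* & 0 & 0 & 0 & 0 & \cdots \\ {D} & -C^* & 0 & 0 & 0 & 0 & \cdots \\ \hline 0 & 0 & I & 0 & 0 & 0 & \cdots \\ 0 & 0 & 0 & I & 0 & 0 & \cdots \\ 0 & 0 & 0 & 0 & I & 0 & \cdots \\ \vdots & \vdots & \vdots & \vdots & \vdots & \ddots & \ddots \end{array}\right].$$ Then $V$ is an isometric dilation of the sequence $\{A_n\}_{n\ge0}$ given by $A_0=I$ and $A_n=A^{-1/2}T^nA^{-1/2}$ for $n\ge1$; that is, $V$ is an isometry and $A_n=P_{\mathcal{H}}V^n|_{\mathcal{H}}$ for all $n\ge0$.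
   Context: $\ell^2(\mathcal{H})=\mathcal{H}\oplus\mathcal{H}\oplus\cdots$. $P_{\mathcal{H}}$ is the orthogonal projection of $\mathcal{K}$ onto the first summand $\mathcal{H}$. Under the stated hypotheses $I+A(A-2I)C^*C=I-C^*C+(A-I)^2C^*C$ is a positive operator, so $B$ is well defined. Explicitly, $V(h_1,h_2,h_3,k_0,k_1,\dots)=(BDCh_1+BDD_*h_2,\ (A-I)CBCh_1+(A-I)CBD_*h_2,\ Dh_1-C^*h_2,\ h_3,k_0,k_1,\dots)$. *)

theory Defs
  imports "HOL-Analysis.Analysis"
begin

section \<open>Complex Hilbert spaces\<close>

text \<open>
  The inner product is linear in its first argument.  Positive definiteness is contained in the last
  axiom, which says that the norm is the one induced by the inner product; completeness is part of
  the class \<open>banach\<close>.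
\<close>

class chilbert_space = banach +
  fixes scaleC :: "complex \<Rightarrow> 'a \<Rightarrow> 'a" (infixr \<open>*\<^sub>C\<close> 75)
    and cinner :: "'a \<Rightarrow> 'a \<Rightarrow> complex"
  assumes scaleC_add_right: "c *\<^sub>C (x + y) = c *\<^sub>C x + c *\<^sub>C y"
    and scaleC_add_left: "(c + d) *\<^sub>C x = c *\<^sub>C x + d *\<^sub>C x"
    and scaleC_scaleC: "c *\<^sub>C d *\<^sub>C x = (c * d) *\<^sub>C x"
    and scaleR_scaleC: "r *\<^sub>R x = complex_of_real r *\<^sub>C x"
    and cinner_commute: "cinner x y = cnj (cinner y x)"
    and cinner_add_left: "cinner (x + y) z = cinner x z + cinner y z"
    and cinner_scaleC_left: "cinner (c *\<^sub>C x) y = c * cinner x y"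
    and cinner_self: "cinner x x = complex_of_real ((norm x)\<^sup>2)"
begin

lemma cinner_add_right: "cinner x (y + z) = cinner x y + cinner x z"
  by (metis cinner_add_left cinner_commute complex_cnj_add)

lemma cinner_scaleC_right: "cinner x (c *\<^sub>C y) = cnj c * cinner x y"
  by (metis cinner_commute cinner_scaleC_left complex_cnj_mult)

lemma norm_scaleC: "norm (c *\<^sub>C x) = cmod c * norm x"
proof -
  have "complex_of_real ((norm (c *\<^sub>C x))\<^sup>2) = c * cnj c * complex_of_real ((norm x)\<^sup>2)"
    unfolding cinner_self[symmetric] cinner_scaleC_left cinner_scaleC_right by (simp add: mult.assoc)
  also have "\<dots> = complex_of_real ((cmod c * norm x)\<^sup>2)"
    by (simp add: complex_norm_square[symmetric] power_mult_distrib)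
  finally have "(norm (c *\<^sub>C x))\<^sup>2 = (cmod c * norm x)\<^sup>2"
    using of_real_eq_iff by blast
  then show ?thesis
    by (simp add: power2_eq_iff_nonneg)
qed

lemma Re_cinner_le: "Re (cinner x y) \<le> norm x * norm y"
proof -
  have "complex_of_real ((norm (x + y))\<^sup>2) = cinner x x + cinner x y + (cinner y x + cinner y y)"
    unfolding cinner_self[symmetric] cinner_add_left cinner_add_right by (simp add: algebra_simps)
  then have "(norm (x + y))\<^sup>2 = Re (cinner x x) + Re (cinner x y) + (Re (cinner y x) + Re (cinner y y))"
    by (metis Re_complex_of_real plus_complex.sel(1))
  moreover have "Re (cinner y x) = Re (cinner x y)"
    by (metis cinner_commute complex_cnj(1) complex.collapse complex.sel(1))
  moreover have "Re (cinner x x) = (norm x)\<^sup>2" "Re (cinner y y) = (norm y)\<^sup>2"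
    by (simp_all only: cinner_self Re_complex_of_real)
  moreover have "(norm (x + y))\<^sup>2 \<le> (norm x + norm y)\<^sup>2"
    by (intro power_mono norm_triangle_ineq norm_ge_zero)
  ultimately show ?thesis
    by (simp add: power2_sum)
qed

lemma norm_cinner_le: "cmod (cinner x y) \<le> norm x * norm y"
proof (cases "cinner x y = 0")
  case False
  define c where "c = cnj (cinner x y) / complex_of_real (cmod (cinner x y))"
  have c: "cmod c = 1"
    using False by (simp add: c_def norm_divide)
  have "c * cinner x y = complex_of_real (cmod (cinner x y))"
    using False complex_norm_square[of "cinner x y"]
    by (simp add: c_def field_simps power2_eq_square)
  then have "cmod (cinner x y) = Re (cinner (c *\<^sub>C x) y)"
    by (simp add: cinner_scaleC_left)
  also have "\<dots> \<le> norm (c *\<^sub>C x) * norm y"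
    by (rule Re_cinner_le)
  finally show ?thesis
    by (simp add: norm_scaleC c)
qed simp

end

definition clinear_map :: "('a::chilbert_space \<Rightarrow> 'b::chilbert_space) \<Rightarrow> bool" where
  "clinear_map f \<longleftrightarrow> (\<forall>x y. f (x + y) = f x + f y) \<and> (\<forall>c x. f (c *\<^sub>C x) = c *\<^sub>C f x)"

instantiation prod :: (chilbert_space, chilbert_space) chilbert_space
begin

definition scaleC_prod :: "complex \<Rightarrow> 'a \<times> 'b \<Rightarrow> 'a \<times> 'b" where
  "c *\<^sub>C p = (c *\<^sub>C fst p, c *\<^sub>C snd p)"

definition cinner_prod :: "'a \<times> 'b \<Rightarrow> 'a \<times> 'b \<Rightarrow> complex" where
  "cinner p q = cinner (fst p) (fst q) + cinner (snd p) (snd q)"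

instance
proof
  fix c d :: complex and r :: real and x y z :: "'a \<times> 'b"
  show "c *\<^sub>C (x + y) = c *\<^sub>C x + c *\<^sub>C y" "(c + d) *\<^sub>C x = c *\<^sub>C x + d *\<^sub>C x"
    "c *\<^sub>C d *\<^sub>C x = (c * d) *\<^sub>C x"
    by (simp_all add: scaleC_prod_def scaleC_add_right scaleC_add_left scaleC_scaleC)
  show "r *\<^sub>R x = complex_of_real r *\<^sub>C x"
    by (simp add: scaleC_prod_def scaleR_prod_def scaleR_scaleC)
  show "cinner x y = cnj (cinner y x)"
    unfolding cinner_prod_def complex_cnj_add by (metis cinner_commute)
  show "cinner (x + y) z = cinner x z + cinner y z" "cinner (c *\<^sub>C x) y = c * cinner x y"
    by (simp_all add: cinner_prod_def scaleC_prod_def cinner_add_left cinner_scaleC_left algebra_simps)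
  show "cinner x x = complex_of_real ((norm x)\<^sup>2)"
    by (simp add: cinner_prod_def cinner_self norm_prod_def)
qed

end

section \<open>The Hilbert space of square-summable sequences\<close>

typedef (overloaded) 'a ell2 = "{x :: nat \<Rightarrow> 'a::chilbert_space. summable (\<lambda>n. (norm (x n))\<^sup>2)}"
  morphisms ell2_nth Abs_ell2
  by (rule exI[of _ "\<lambda>_. 0"]) simp

setup_lifting type_definition_ell2

lemma ell2_eqI: "(\<And>n. ell2_nth x n = ell2_nth y n) \<Longrightarrow> x = y"
  by (simp add: ell2_nth_inject[symmetric] fun_eq_iff)

lemma summable_ell2: "summable (\<lambda>n. (norm (ell2_nth x n))\<^sup>2)"
  using ell2_nth[of x] by simp

lemma square_summable_add:
  fixes x y :: "nat \<Rightarrow> 'a::chilbert_space"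
  assumes "summable (\<lambda>n. (norm (x n))\<^sup>2)" "summable (\<lambda>n. (norm (y n))\<^sup>2)"
  shows "summable (\<lambda>n. (norm (x n + y n))\<^sup>2)"
proof (rule summable_comparison_test')
  show "summable (\<lambda>n. 2 * (norm (x n))\<^sup>2 + 2 * (norm (y n))\<^sup>2)"
    by (intro summable_add summable_mult assms)
  fix n
  have "(norm (x n + y n))\<^sup>2 \<le> (norm (x n) + norm (y n))\<^sup>2"
    by (intro power_mono norm_triangle_ineq norm_ge_zero)
  also have "\<dots> \<le> 2 * (norm (x n))\<^sup>2 + 2 * (norm (y n))\<^sup>2"
    using sum_squares_bound[of "norm (x n)" "norm (y n)"] by (simp add: power2_sum)
  finally show "norm ((norm (x n + y n))\<^sup>2) \<le> 2 * (norm (x n))\<^sup>2 + 2 * (norm (y n))\<^sup>2"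
    by simp
qed

lemma square_summable_scaleC:
  fixes x :: "nat \<Rightarrow> 'a::chilbert_space"
  assumes "summable (\<lambda>n. (norm (x n))\<^sup>2)"
  shows "summable (\<lambda>n. (norm (c *\<^sub>C x n))\<^sup>2)"
  using summable_mult[OF assms, of "(cmod c)\<^sup>2"] by (simp add: norm_scaleC power_mult_distrib)

lemma square_summable_minus:
  fixes x y :: "nat \<Rightarrow> 'a::chilbert_space"
  assumes "summable (\<lambda>n. (norm (x n))\<^sup>2)" "summable (\<lambda>n. (norm (y n))\<^sup>2)"
  shows "summable (\<lambda>n. (norm (x n - y n))\<^sup>2)"
  using square_summable_add[OF assms(1), of "\<lambda>n. - y n"] assms(2) by simp

lemma summable_cinner:
  fixes x y :: "nat \<Rightarrow> 'a::chilbert_space"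
  assumes "summable (\<lambda>n. (norm (x n))\<^sup>2)" "summable (\<lambda>n. (norm (y n))\<^sup>2)"
  shows "summable (\<lambda>n. cinner (x n) (y n))"
proof (rule summable_comparison_test')
  show "summable (\<lambda>n. (norm (x n))\<^sup>2 + (norm (y n))\<^sup>2)"
    by (intro summable_add assms)
  fix n
  have "cmod (cinner (x n) (y n)) \<le> norm (x n) * norm (y n)"
    by (rule norm_cinner_le)
  also have "\<dots> \<le> 2 * norm (x n) * norm (y n)"
    by simp
  also have "\<dots> \<le> (norm (x n))\<^sup>2 + (norm (y n))\<^sup>2"
    by (rule sum_squares_bound)
  finally show "cmod (cinner (x n) (y n)) \<le> (norm (x n))\<^sup>2 + (norm (y n))\<^sup>2" .
qed

instantiation ell2 :: (chilbert_space) real_normed_vector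
begin

lift_definition zero_ell2 :: "'a ell2" is "\<lambda>_. 0" by simp
lift_definition plus_ell2 :: "'a ell2 \<Rightarrow> 'a ell2 \<Rightarrow> 'a ell2" is "\<lambda>x y n. x n + y n"
  by (rule square_summable_add)
lift_definition minus_ell2 :: "'a ell2 \<Rightarrow> 'a ell2 \<Rightarrow> 'a ell2" is "\<lambda>x y n. x n - y n"
  by (rule square_summable_minus)
lift_definition uminus_ell2 :: "'a ell2 \<Rightarrow> 'a ell2" is "\<lambda>x n. - x n" by simp
lift_definition scaleR_ell2 :: "real \<Rightarrow> 'a ell2 \<Rightarrow> 'a ell2" is "\<lambda>r x n. r *\<^sub>R x n"
  by (simp only: scaleR_scaleC square_summable_scaleC)
lift_definition norm_ell2 :: "'a ell2 \<Rightarrow> real" is "\<lambda>x. sqrt (\<Sum>n. (norm (x n))\<^sup>2)" .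

definition dist_ell2 :: "'a ell2 \<Rightarrow> 'a ell2 \<Rightarrow> real" where "dist_ell2 x y = norm (x - y)"
definition sgn_ell2 :: "'a ell2 \<Rightarrow> 'a ell2" where "sgn_ell2 x = inverse (norm x) *\<^sub>R x"
definition uniformity_ell2 :: "('a ell2 \<times> 'a ell2) filter" where
  "uniformity_ell2 = (INF e\<in>{0 <..}. principal {(x, y). dist x y < e})"
definition open_ell2 :: "'a ell2 set \<Rightarrow> bool" where
  "open_ell2 U \<longleftrightarrow> (\<forall>x\<in>U. eventually (\<lambda>(x', y). x' = x \<longrightarrow> y \<in> U) uniformity)"

lemma sum_le_norm_ell2: "(\<Sum>n<N. (norm (ell2_nth x n))\<^sup>2) \<le> (norm x)\<^sup>2"
proof -
  have "0 \<le> (\<Sum>n. (norm (ell2_nth x n))\<^sup>2)"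
    by (intro suminf_nonneg summable_ell2) simp
  then have "(norm x)\<^sup>2 = (\<Sum>n. (norm (ell2_nth x n))\<^sup>2)"
    by (simp add: norm_ell2.rep_eq)
  then show ?thesis
    using sum_le_suminf[OF summable_ell2[of x], of "{..<N}"] by simp
qed

lemma norm_ell2_le:
  assumes "0 \<le> e" "\<And>N. (\<Sum>n<N. (norm (ell2_nth x n))\<^sup>2) \<le> e\<^sup>2"
  shows "norm x \<le> e"
proof -
  have "(\<Sum>n. (norm (ell2_nth x n))\<^sup>2) \<le> e\<^sup>2"
    by (intro suminf_le_const summable_ell2 assms)
  then show ?thesis
    using assms(1) by (simp add: norm_ell2.rep_eq real_le_lsqrt)
qed

lemma norm_nth_le_ell2: "norm (ell2_nth x n) \<le> norm x"
proof -
  have "(norm (ell2_nth x n))\<^sup>2 \<le> (\<Sum>k<Suc n. (norm (ell2_nth x k))\<^sup>2)"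
    by (simp add: sum_nonneg)
  also have "\<dots> \<le> (norm x)\<^sup>2"
    by (rule sum_le_norm_ell2)
  finally have "\<bar>norm (ell2_nth x n)\<bar> \<le> \<bar>norm x\<bar>"
    by (simp only: abs_le_square_iff)
  moreover have "0 \<le> norm x"
    by (simp add: norm_ell2.rep_eq suminf_nonneg[OF summable_ell2])
  ultimately show ?thesis
    by simp
qed

instance
proof
  fix a b :: real and x y z :: "'a ell2" and U :: "'a ell2 set"
  show "x + y + z = x + (y + z)" "x + y = y + x" "0 + x = x" "- x + x = 0" "x - y = x + - y"
    "a *\<^sub>R (x + y) = a *\<^sub>R x + a *\<^sub>R y" "(a + b) *\<^sub>R x = a *\<^sub>R x + b *\<^sub>R x"
    "a *\<^sub>R b *\<^sub>R x = (a * b) *\<^sub>R x" "1 *\<^sub>R x = x"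
    by (transfer; simp add: fun_eq_iff algebra_simps)+
  show "dist x y = norm (x - y)" by (rule dist_ell2_def)
  show "sgn x = inverse (norm x) *\<^sub>R x" by (rule sgn_ell2_def)
  show "uniformity = (INF e\<in>{0 <..}. principal {(x, y :: 'a ell2). dist x y < e})"
    by (rule uniformity_ell2_def)
  show "open U \<longleftrightarrow> (\<forall>x\<in>U. \<forall>\<^sub>F (x', y) in uniformity. x' = x \<longrightarrow> y \<in> U)"
    by (rule open_ell2_def)
  have nonneg: "0 \<le> norm w" for w :: "'a ell2"
    by (simp add: norm_ell2.rep_eq suminf_nonneg[OF summable_ell2])
  show "norm x = 0 \<longleftrightarrow> x = 0"
  proof
    assume "norm x = 0"
    then have "ell2_nth x n = 0" for n
      using norm_nth_le_ell2[of x n] by simp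
    then show "x = 0"
      by (intro ell2_eqI) (simp add: zero_ell2.rep_eq)
  qed (simp add: norm_ell2.rep_eq zero_ell2.rep_eq)
  show "norm (x + y) \<le> norm x + norm y"
  proof (rule norm_ell2_le)
    show "0 \<le> norm x + norm y"
      using nonneg by (simp add: add_nonneg_nonneg)
    fix N
    have bound: "L2_set (\<lambda>n. norm (ell2_nth w n)) {..<N} \<le> norm w" for w :: "'a ell2"
      unfolding L2_set_def using sum_le_norm_ell2[of w N] nonneg[of w] by (rule real_le_lsqrt[rotated])
    have "L2_set (\<lambda>n. norm (ell2_nth (x + y) n)) {..<N}
        \<le> L2_set (\<lambda>n. norm (ell2_nth x n) + norm (ell2_nth y n)) {..<N}"
      by (intro L2_set_mono) (simp_all add: plus_ell2.rep_eq norm_triangle_ineq)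
    also have "\<dots> \<le> L2_set (\<lambda>n. norm (ell2_nth x n)) {..<N} + L2_set (\<lambda>n. norm (ell2_nth y n)) {..<N}"
      by (rule L2_set_triangle_ineq)
    also have "\<dots> \<le> norm x + norm y"
      by (intro add_mono bound)
    finally show "(\<Sum>n<N. (norm (ell2_nth (x + y) n))\<^sup>2) \<le> (norm x + norm y)\<^sup>2"
      unfolding L2_set_def by (rule sqrt_le_D)
  qed
  show "norm (a *\<^sub>R x) = \<bar>a\<bar> * norm x"
    by (simp add: norm_ell2.rep_eq scaleR_ell2.rep_eq power_mult_distrib suminf_mult[OF summable_ell2]
        real_sqrt_mult)
qed

end

instance ell2 :: (chilbert_space) banach
proof
  fix X :: "nat \<Rightarrow> 'a ell2"
  assume X: "Cauchy X"
  have "Cauchy (\<lambda>k. ell2_nth (X k) n)" for n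
  proof (rule CauchyI)
    fix e :: real
    assume "0 < e"
    then obtain M where M: "\<forall>m\<ge>M. \<forall>k\<ge>M. norm (X m - X k) < e"
      using CauchyD[OF X] by blast
    have "norm (ell2_nth (X m) n - ell2_nth (X k) n) < e" if "m \<ge> M" "k \<ge> M" for m k
      using norm_nth_le_ell2[of "X m - X k" n] M that
      by (metis le_less_trans minus_ell2.rep_eq)
    then show "\<exists>M. \<forall>m\<ge>M. \<forall>k\<ge>M. norm (ell2_nth (X m) n - ell2_nth (X k) n) < e"
      by blast
  qed
  then have "\<exists>l. (\<lambda>k. ell2_nth (X k) n) \<longlonglongrightarrow> l" for n
    using Cauchy_convergent convergent_def by blast
  then obtain l where l: "\<And>n. (\<lambda>k. ell2_nth (X k) n) \<longlonglongrightarrow> l n"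
    by metis
  have tail: "\<exists>M. \<forall>m\<ge>M. \<forall>N. (\<Sum>n<N. (norm (ell2_nth (X m) n - l n))\<^sup>2) \<le> e\<^sup>2" if e: "0 < e" for e
  proof -
    obtain M where M: "\<forall>m\<ge>M. \<forall>k\<ge>M. norm (X m - X k) < e"
      using CauchyD[OF X e] by blast
    have "(\<Sum>n<N. (norm (ell2_nth (X m) n - l n))\<^sup>2) \<le> e\<^sup>2" if m: "m \<ge> M" for m N
    proof (rule LIMSEQ_le_const2)
      show "(\<lambda>k. \<Sum>n<N. (norm (ell2_nth (X m) n - ell2_nth (X k) n))\<^sup>2)
          \<longlonglongrightarrow> (\<Sum>n<N. (norm (ell2_nth (X m) n - l n))\<^sup>2)"
        by (intro tendsto_intros l)
      have "(\<Sum>n<N. (norm (ell2_nth (X m) n - ell2_nth (X k) n))\<^sup>2) \<le> e\<^sup>2" if "k \<ge> M" for k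
      proof -
        have "(\<Sum>n<N. (norm (ell2_nth (X m) n - ell2_nth (X k) n))\<^sup>2) \<le> (norm (X m - X k))\<^sup>2"
          using sum_le_norm_ell2[of "X m - X k" N] by (simp add: minus_ell2.rep_eq)
        also have "\<dots> \<le> e\<^sup>2"
          using M m that by (intro power_mono) (auto intro: less_imp_le)
        finally show ?thesis .
      qed
      then show "\<exists>M. \<forall>k\<ge>M. (\<Sum>n<N. (norm (ell2_nth (X m) n - ell2_nth (X k) n))\<^sup>2) \<le> e\<^sup>2"
        by blast
    qed
    then show ?thesis
      by blast
  qed
  obtain m where "\<forall>N. (\<Sum>n<N. (norm (ell2_nth (X m) n - l n))\<^sup>2) \<le> 1\<^sup>2"
    using tail[of 1] by auto
  then have "summable (\<lambda>n. (norm (ell2_nth (X m) n - l n))\<^sup>2)"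
    by (intro summableI_nonneg_bounded[where x = "1\<^sup>2"]) auto
  from square_summable_minus[OF summable_ell2[of "X m"] this]
  have "summable (\<lambda>n. (norm (l n))\<^sup>2)"
    by simp
  then have nth: "ell2_nth (Abs_ell2 l) = l"
    by (simp add: Abs_ell2_inverse)
  have "X \<longlonglongrightarrow> Abs_ell2 l"
  proof (rule LIMSEQ_I)
    fix e :: real
    assume e: "0 < e"
    then obtain M where M: "\<forall>m\<ge>M. \<forall>N. (\<Sum>n<N. (norm (ell2_nth (X m) n - l n))\<^sup>2) \<le> (e / 2)\<^sup>2"
      using tail[of "e / 2"] by auto
    have "norm (X m - Abs_ell2 l) \<le> e / 2" if "m \<ge> M" for m
      using M that e by (intro norm_ell2_le) (auto simp: minus_ell2.rep_eq nth)
    then show "\<exists>M. \<forall>m\<ge>M. norm (X m - Abs_ell2 l) < e"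
      using e by (intro exI[of _ M]) force
  qed
  then show "convergent X"
    by (rule convergentI)
qed

instantiation ell2 :: (chilbert_space) chilbert_space
begin

lift_definition scaleC_ell2 :: "complex \<Rightarrow> 'a ell2 \<Rightarrow> 'a ell2" is "\<lambda>c x n. c *\<^sub>C x n"
  by (rule square_summable_scaleC)
lift_definition cinner_ell2 :: "'a ell2 \<Rightarrow> 'a ell2 \<Rightarrow> complex" is "\<lambda>x y. \<Sum>n. cinner (x n) (y n)" .

instance
proof
  fix c d :: complex and r :: real and x y z :: "'a ell2"
  show "c *\<^sub>C (x + y) = c *\<^sub>C x + c *\<^sub>C y" "(c + d) *\<^sub>C x = c *\<^sub>C x + d *\<^sub>C x"
    "c *\<^sub>C d *\<^sub>C x = (c * d) *\<^sub>C x" "r *\<^sub>R x = complex_of_real r *\<^sub>C x"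
    by (transfer; simp add: fun_eq_iff scaleC_add_right scaleC_add_left scaleC_scaleC scaleR_scaleC)+
  have sm: "summable (\<lambda>n. cinner (ell2_nth v n) (ell2_nth w n))" for v w :: "'a ell2"
    by (intro summable_cinner summable_ell2)
  have "(\<lambda>n. cinner (ell2_nth y n) (ell2_nth x n)) sums cinner y x"
    unfolding cinner_ell2.rep_eq by (rule summable_sums[OF sm])
  then have "(\<lambda>n. cnj (cinner (ell2_nth y n) (ell2_nth x n))) sums cnj (cinner y x)"
    by (simp only: sums_cnj)
  then show "cinner x y = cnj (cinner y x)"
    unfolding cinner_commute[symmetric] cinner_ell2.rep_eq[of x y] by (rule sums_unique[symmetric])
  show "cinner (x + y) z = cinner x z + cinner y z"
    by (simp add: cinner_ell2.rep_eq plus_ell2.rep_eq cinner_add_left suminf_add[OF sm sm])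
  show "cinner (c *\<^sub>C x) y = c * cinner x y"
    by (simp add: cinner_ell2.rep_eq scaleC_ell2.rep_eq cinner_scaleC_left suminf_mult[OF sm])
  have "0 \<le> (\<Sum>n. (norm (ell2_nth x n))\<^sup>2)"
    by (intro suminf_nonneg summable_ell2) simp
  then show "cinner x x = complex_of_real ((norm x)\<^sup>2)"
    by (simp only: cinner_ell2.rep_eq norm_ell2.rep_eq cinner_self real_sqrt_pow2
        suminf_of_real[OF summable_ell2])
qed

end

lift_definition ell2_cons :: "'a \<Rightarrow> 'a ell2 \<Rightarrow> 'a::chilbert_space ell2" is "\<lambda>h k. case_nat h k"
  by (subst summable_Suc_iff[symmetric]) simp

section \<open>Bounded operators\<close>

typedef (overloaded) 'a bop = "{T :: 'a::chilbert_space \<Rightarrow>\<^sub>L 'a. \<forall>c x. T (c *\<^sub>C x) = c *\<^sub>C T x}"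
  morphisms blinfun_of_bop Abs_bop
  by (rule exI[of _ "0 :: 'a \<Rightarrow>\<^sub>L 'a"]) (simp add: zero_blinfun.rep_eq,
      metis add_cancel_right_right scaleC_add_right)

setup_lifting type_definition_bop

lift_definition bop_apply :: "'a::chilbert_space bop \<Rightarrow> 'a \<Rightarrow> 'a" is blinfun_apply .

declare [[coercion bop_apply]]

lemma bop_eqI: "(\<And>x. bop_apply S x = bop_apply T x) \<Longrightarrow> S = T"
  by transfer (rule blinfun_eqI)

lemma scaleC_zero_right: "c *\<^sub>C 0 = (0 :: 'a::chilbert_space)"
  by (metis add_cancel_right_right scaleC_add_right)

lemma scaleC_minus_right: "c *\<^sub>C (- x) = - (c *\<^sub>C x :: 'a::chilbert_space)"
  by (metis add.right_inverse minus_unique scaleC_add_right scaleC_zero_right)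

lemma scaleC_diff_right: "c *\<^sub>C (x - y) = c *\<^sub>C x - (c *\<^sub>C y :: 'a::chilbert_space)"
  by (metis diff_conv_add_uminus scaleC_add_right scaleC_minus_right)

lemma scaleC_scaleR_commute: "c *\<^sub>C r *\<^sub>R x = r *\<^sub>R c *\<^sub>C (x :: 'a::chilbert_space)"
  by (simp add: scaleR_scaleC scaleC_scaleC mult.commute)

instantiation bop :: (chilbert_space) real_normed_algebra
begin

lift_definition zero_bop :: "'a bop" is 0
  by (simp add: scaleC_zero_right)
lift_definition plus_bop :: "'a bop \<Rightarrow> 'a bop \<Rightarrow> 'a bop" is "(+)"
  by (simp add: blinfun.add_left scaleC_add_right)
lift_definition minus_bop :: "'a bop \<Rightarrow> 'a bop \<Rightarrow> 'a bop" is "(-)"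
  by (simp add: blinfun.diff_left scaleC_diff_right)
lift_definition uminus_bop :: "'a bop \<Rightarrow> 'a bop" is uminus
  by (simp add: blinfun.minus_left scaleC_minus_right)
lift_definition scaleR_bop :: "real \<Rightarrow> 'a bop \<Rightarrow> 'a bop" is "(*\<^sub>R)"
  by (simp add: blinfun.scaleR_left scaleC_scaleR_commute)
lift_definition times_bop :: "'a bop \<Rightarrow> 'a bop \<Rightarrow> 'a bop" is "(o\<^sub>L)"
  by simp
lift_definition norm_bop :: "'a bop \<Rightarrow> real" is norm .

definition dist_bop :: "'a bop \<Rightarrow> 'a bop \<Rightarrow> real" where "dist_bop S T = norm (S - T)"
definition sgn_bop :: "'a bop \<Rightarrow> 'a bop" where "sgn_bop T = inverse (norm T) *\<^sub>R T"
definition uniformity_bop :: "('a bop \<times> 'a bop) filter" where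
  "uniformity_bop = (INF e\<in>{0 <..}. principal {(S, T). dist S T < e})"
definition open_bop :: "'a bop set \<Rightarrow> bool" where
  "open_bop U \<longleftrightarrow> (\<forall>S\<in>U. eventually (\<lambda>(S', T). S' = S \<longrightarrow> T \<in> U) uniformity)"

instance
proof
  fix a b :: real and R S T :: "'a bop" and U :: "'a bop set"
  show "R + S + T = R + (S + T)" "R + S = S + R" "0 + R = R" "- R + R = 0" "R - S = R + - S"
    "a *\<^sub>R (R + S) = a *\<^sub>R R + a *\<^sub>R S" "(a + b) *\<^sub>R R = a *\<^sub>R R + b *\<^sub>R R"
    "a *\<^sub>R b *\<^sub>R R = (a * b) *\<^sub>R R" "1 *\<^sub>R R = R"
    by (transfer; simp add: algebra_simps)+
  show "R * S * T = R * (S * T)" "(R + S) * T = R * T + S * T" "R * (S + T) = R * S + R * T"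
    "a *\<^sub>R R * S = a *\<^sub>R (R * S)" "R * a *\<^sub>R S = a *\<^sub>R (R * S)"
    by (transfer; auto intro!: blinfun_eqI simp: blinfun.bilinear_simps)+
  show "norm (R * S) \<le> norm R * norm S"
    by transfer (rule norm_blinfun_compose)
  show "norm R = 0 \<longleftrightarrow> R = 0" "norm (R + S) \<le> norm R + norm S" "norm (a *\<^sub>R R) = \<bar>a\<bar> * norm R"
    by (transfer; simp add: norm_triangle_ineq)+
  show "dist R S = norm (R - S)" by (rule dist_bop_def)
  show "sgn R = inverse (norm R) *\<^sub>R R" by (rule sgn_bop_def)
  show "uniformity = (INF e\<in>{0 <..}. principal {(S, T :: 'a bop). dist S T < e})"
    by (rule uniformity_bop_def)
  show "open U \<longleftrightarrow> (\<forall>S\<in>U. \<forall>\<^sub>F (S', T) in uniformity. S' = S \<longrightarrow> T \<in> U)"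
    by (rule open_bop_def)
qed

end

text \<open>The class \<open>ring_1\<close> is not available, since \<open>0 = 1\<close> on the zero space.\<close>

instantiation bop :: (chilbert_space) monoid_mult
begin

lift_definition one_bop :: "'a bop" is id_blinfun by simp

instance
  by standard (transfer; auto intro!: blinfun_eqI)+

end

lemma bop_apply_simps [simp]:
  "bop_apply 0 x = 0" "bop_apply 1 x = x"
  "bop_apply (S + T) x = bop_apply S x + bop_apply T x"
  "bop_apply (S - T) x = bop_apply S x - bop_apply T x"
  "bop_apply (- T) x = - bop_apply T x"
  "bop_apply (r *\<^sub>R T) x = r *\<^sub>R bop_apply T x"
  "bop_apply (S * T) x = bop_apply S (bop_apply T x)"
  by (transfer; simp add: blinfun.bilinear_simps)+

text \<open>
  The definitions by \<open>THE\<close> below determine the operator uniquely in the intended cases (every operator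
  has exactly one adjoint, every positive operator exactly one positive square root); outside of
  these, for instance for the inverse of a non-invertible operator, nothing is known about the value.
\<close>

definition bop_adj :: "'a::chilbert_space bop \<Rightarrow> 'a bop" (\<open>_\<^sup>*\<close> [1000] 999) where
  "T\<^sup>* = (THE S. \<forall>x y. cinner (bop_apply T x) y = cinner x (bop_apply S y))"

definition bop_invertible :: "'a::chilbert_space bop \<Rightarrow> bool" where
  "bop_invertible T \<longleftrightarrow> (\<exists>S. S * T = 1 \<and> T * S = 1)"

definition bop_inv :: "'a::chilbert_space bop \<Rightarrow> 'a bop" where
  "bop_inv T = (THE S. S * T = 1 \<and> T * S = 1)"

definition bop_positive :: "'a::chilbert_space bop \<Rightarrow> bool" where
  "bop_positive T \<longleftrightarrow> (\<forall>x. cinner (bop_apply T x) x \<in> \<real>\<^sub>\<ge>\<^sub>0)"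

definition bop_sqrt :: "'a::chilbert_space bop \<Rightarrow> 'a bop" where
  "bop_sqrt T = (THE S. bop_positive S \<and> S * S = T)"

text \<open>The power with exponent \<open>-1/2\<close> of a positive invertible operator.\<close>

definition bop_inv_sqrt :: "'a::chilbert_space bop \<Rightarrow> 'a bop" where
  "bop_inv_sqrt T = bop_sqrt (bop_inv T)"

section \<open>Isometric dilations\<close>

definition is_isometry :: "('a::chilbert_space \<Rightarrow> 'b::chilbert_space) \<Rightarrow> bool" where
  "is_isometry V \<longleftrightarrow> clinear_map V \<and> (\<forall>x. norm (V x) = norm x)"

definition orth_proj :: "'a::chilbert_space set \<Rightarrow> 'a \<Rightarrow> 'a" where
  "orth_proj M x = (THE p. p \<in> M \<and> (\<forall>m\<in>M. cinner (x - p) m = 0))"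

text \<open>
  The sequence \<open>X\<close> is the one being dilated: \<open>X n\<close> is the compression of the \<open>n\<close>th power of \<open>V\<close>.
  The isometry \<open>J\<close> identifies the smaller space with the closed subspace \<open>range J\<close> of the larger one.
\<close>

definition isometric_dilation ::
  "('a::chilbert_space \<Rightarrow> 'k::chilbert_space) \<Rightarrow> ('k \<Rightarrow> 'k) \<Rightarrow> (nat \<Rightarrow> 'a bop) \<Rightarrow> bool" where
  "isometric_dilation J V X \<longleftrightarrow>
     is_isometry J \<and> is_isometry V \<and>
     (\<forall>n h. J (bop_apply (X n) h) = orth_proj (range J) ((V ^^ n) (J h)))"

type_synonym 'a dilation_space = "('a \<times> 'a \<times> 'a) \<times> 'a ell2"

definition first_summand :: "'a::chilbert_space \<Rightarrow> 'a dilation_space" where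
  "first_summand h = ((h, 0, 0), 0)"

end

theory Submission
  imports Defs
begin

text \<open>
  Put \<open>N = C\<^sup>* C\<close> and \<open>M = 1 + A (A - 2) N = (1 - N) + (A - 1)\<^sup>2 N\<close>, so that \<open>B\<^sup>2 = M\<^sup>-\<^sup>1\<close>.  The operator
  \<open>A\<close> commutes with \<open>B\<close>, \<open>C\<close>, \<open>D\<close>, moreover \<open>B D = D B\<close> and \<open>Ds C = C D\<close>.  With \<open>u = C h1 + Ds h2\<close> the first
  two coordinates of \<open>V\<close> are \<open>B D u\<close> and \<open>(A - 1) C B u\<close>, whose squared norms add up to \<open>\<langle>B M B u, u\<rangle> = \<parallel>u\<parallel>\<^sup>2\<close>,
  and \<open>\<parallel>u\<parallel>\<^sup>2 + \<parallel>D h1 - C\<^sup>* h2\<parallel>\<^sup>2 = \<parallel>h1\<parallel>\<^sup>2 + \<parallel>h2\<parallel>\<^sup>2\<close> because the Julia operator of \<open>C\<close> is unitary.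
  For the compressions, \<open>V\<close> maps a vector with first two coordinates \<open>(B D C y, (A - 1) C B C y)\<close> to
  one with first two coordinates of the same form with \<open>T y\<close> in place of \<open>y\<close>.
\<close>

section \<open>Inner products and the Riesz representation\<close>

lemma cinner_zero_left [simp]: "cinner 0 (y :: 'a::chilbert_space) = 0"
  using cinner_add_left[of 0 0 y] by simp

lemma cinner_zero_right [simp]: "cinner (x :: 'a::chilbert_space) 0 = 0"
  using cinner_add_right[of x 0 0] by simp

lemma cinner_diff_left: "cinner (x - y) z = cinner x z - cinner (y :: 'a::chilbert_space) z"
  using cinner_add_left[of "x - y" y z] by simp

lemma cinner_diff_right: "cinner x (y - z) = cinner x y - cinner (x :: 'a::chilbert_space) z"
  using cinner_add_right[of x "y - z" z] by simp

lemma cinner_scaleR_left: "cinner (r *\<^sub>R x) y = of_real r * cinner (x :: 'a::chilbert_space) y"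
  by (simp add: scaleR_scaleC cinner_scaleC_left)

lemma cinner_scaleR_right: "cinner x (r *\<^sub>R y) = of_real r * cinner (x :: 'a::chilbert_space) y"
  by (simp add: scaleR_scaleC cinner_scaleC_right)

lemma norm_square: "(norm x)\<^sup>2 = Re (cinner x (x :: 'a::chilbert_space))"
  by (simp add: cinner_self del: of_real_power)

lemma Re_cinner_commute: "Re (cinner x y) = Re (cinner y (x :: 'a::chilbert_space))"
  by (metis cinner_commute complex_cnj(1) complex.collapse complex.sel(1))

lemma norm_add_square:
  "(norm (x + y))\<^sup>2 = (norm x)\<^sup>2 + 2 * Re (cinner x y) + (norm (y :: 'a::chilbert_space))\<^sup>2"
  by (simp add: norm_square cinner_add_left cinner_add_right Re_cinner_commute[of y x])

lemma norm_diff_square: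
  "(norm (x - y))\<^sup>2 = (norm x)\<^sup>2 - 2 * Re (cinner x y) + (norm (y :: 'a::chilbert_space))\<^sup>2"
  by (simp add: norm_square cinner_diff_left cinner_diff_right Re_cinner_commute[of y x])

lemma cinner_eqI:
  fixes y z :: "'a::chilbert_space"
  assumes "\<And>x. cinner x y = cinner x z"
  shows "y = z"
proof -
  have "cinner (y - z) (y - z) = 0"
    unfolding cinner_diff_right using assms by simp
  then show ?thesis
    by (simp add: cinner_self)
qed

text \<open>For small \<open>t\<close> of sign opposite to \<open>a\<close> the linear term would
  dominate and make the sum negative. This is the first-variation argument for the minimiser in
  \<open>real_riesz\<close>.\<close>

lemma linear_term_zero:
  fixes a b :: real
  assumes "\<And>t. 0 \<le> t * a + t\<^sup>2 * b"
  shows "a = 0"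
proof (rule ccontr)
  assume a: "a \<noteq> 0"
  \<comment> \<open>This \<open>t\<close> makes \<open>a + t * (\<bar>b\<bar> + 1)\<close> vanish;
    the extra 1 keeps the denominator positive and gives the strict inequality below.\<close>
  define t where "t = - a / (\<bar>b\<bar> + 1)"
  have "t * a + t\<^sup>2 * b \<le> t * a + t\<^sup>2 * \<bar>b\<bar>"
    by (intro add_left_mono mult_left_mono) auto
  also have "\<dots> < t * a + t\<^sup>2 * (\<bar>b\<bar> + 1)"
    using a by (intro add_strict_left_mono mult_strict_left_mono) (auto simp: t_def)
  also have "\<dots> = t * (a + t * (\<bar>b\<bar> + 1))"
    by (simp add: power2_eq_square algebra_simps)
  also have "t * (\<bar>b\<bar> + 1) = - a"
    by (simp add: t_def add_nonneg_eq_0_iff)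
  finally show False
    using assms[of t] by simp
qed

text \<open>The representing vector is the minimiser of \<open>\<parallel>x\<parallel>\<^sup>2 - 2 g x\<close>; the parallelogram law makes
  minimising sequences Cauchy.\<close>

lemma real_riesz:
  fixes g :: "'a::chilbert_space \<Rightarrow> real"
  assumes g: "bounded_linear g"
  obtains z where "\<And>x. g x = Re (cinner x z)"
proof -
  interpret g: bounded_linear g by (rule g)
  define J where "J x = (norm x)\<^sup>2 - 2 * g x" for x
  obtain K where K: "\<And>x. norm (g x) \<le> norm x * K"
    using g.bounded by blast
  \<comment> \<open>Completing the square in \<open>norm x\<close> after the estimate
    \<open>g x \<le> norm x * K\<close>.\<close>
  have bdd: "- K\<^sup>2 \<le> J x" for x
  proof -
    have "g x \<le> norm x * K"
      using K[of x] by simp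
    moreover have "0 \<le> (norm x - K)\<^sup>2"
      by simp
    ultimately show ?thesis
      by (simp add: J_def power2_diff)
  qed
  define m where "m = (INF x. J x)"
  have bb: "bdd_below (range J)"
    using bdd by (intro bdd_belowI2)
  have m_le: "m \<le> J x" for x
    unfolding m_def using bb by (auto intro: cINF_lower)
  have "\<exists>x. J x < m + 1 / real (Suc n)" for n
  proof -
    have "Inf (range J) < m + 1 / real (Suc n)"
      by (simp add: m_def)
    then show ?thesis
      using cInf_less_iff[of "range J"] bb by auto
  qed
  then obtain X where X: "\<And>n. J (X n) < m + 1 / real (Suc n)"
    by metis
  have par: "(norm (x - y))\<^sup>2 \<le> 2 * (J x - m) + 2 * (J y - m)" for x y
  proof -
    \<comment> \<open>Parallelogram law: the contributions of \<open>g\<close> cancel by linearity,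
      and the midpoint has \<open>J\<close> at least \<open>m\<close>.\<close>
    have "2 * J x + 2 * J y - 4 * J ((1/2) *\<^sub>R (x + y)) = (norm (x - y))\<^sup>2"
      by (simp add: J_def g.add g.scaleR power_divide norm_diff_square norm_add_square cinner_scaleR_left
          cinner_scaleR_right field_simps)
    then show ?thesis
      using m_le[of "(1/2) *\<^sub>R (x + y)"] by simp
  qed
  have "Cauchy X"
  proof (rule CauchyI)
    fix e :: real
    assume e: "0 < e"
    obtain M where M: "inverse (real (Suc M)) < e\<^sup>2 / 4"
      using reals_Archimedean[of "e\<^sup>2 / 4"] e by auto
    have small: "J (X n) - m < e\<^sup>2 / 4" if "M \<le> n" for n
    proof -
      have "1 / real (Suc n) \<le> 1 / real (Suc M)"
        using that by (intro divide_left_mono) auto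
      then show ?thesis
        using X[of n] M by (simp add: inverse_eq_divide)
    qed
    have "norm (X n - X k) < e" if "M \<le> n" "M \<le> k" for n k
    proof -
      have "(norm (X n - X k))\<^sup>2 < e\<^sup>2"
        using par[of "X n" "X k"] small[OF that(1)] small[OF that(2)] by simp
      then show ?thesis
        using e by (simp add: power2_less_imp_less)
    qed
    then show "\<exists>M. \<forall>m\<ge>M. \<forall>n\<ge>M. norm (X m - X n) < e"
      by blast
  qed
  then obtain z where z: "X \<longlonglongrightarrow> z"
    using Cauchy_convergent convergent_def by blast
  have "(\<lambda>n. J (X n)) \<longlonglongrightarrow> J z"
    unfolding J_def by (intro tendsto_intros z g.tendsto)
  moreover have "(\<lambda>n. m + 1 / real (Suc n)) \<longlonglongrightarrow> m + 0"
    by (intro tendsto_intros LIMSEQ_Suc lim_1_over_n)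
  ultimately have "J z \<le> m + 0"
    by (rule LIMSEQ_le) (use X in \<open>auto intro: less_imp_le\<close>)
  then have min: "J z \<le> J x" for x
    using m_le[of x] by simp
  have "g x = Re (cinner x z)" for x
  proof -
    \<comment> \<open>The right-hand side is \<open>J (z + t *\<^sub>R x) - J z\<close>, so its
      linear coefficient must vanish.\<close>
    have "0 \<le> t * (2 * Re (cinner x z) - 2 * g x) + t\<^sup>2 * (norm x)\<^sup>2" for t
      using min[of "z + t *\<^sub>R x"]
      by (simp add: J_def norm_add_square g.add g.scaleR cinner_scaleR_right power_mult_distrib
          Re_cinner_commute[of z x] algebra_simps)
    then show ?thesis
      using linear_term_zero by fastforce
  qed
  then show ?thesis
    using that by blast
qed

section \<open>Adjoints\<close>

lemma bop_apply_add: "bop_apply T (x + y) = bop_apply T x + bop_apply T y"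
  by transfer (simp add: blinfun.add_right)

lemma bop_apply_diff: "bop_apply T (x - y) = bop_apply T x - bop_apply T y"
  by transfer (simp add: blinfun.diff_right)

lemma bop_apply_zero [simp]: "bop_apply T 0 = 0"
  by transfer simp

lemma bop_apply_scaleC: "bop_apply T (c *\<^sub>C x) = c *\<^sub>C bop_apply T x"
  by transfer blast

lemma bop_apply_scaleR: "bop_apply T (r *\<^sub>R x) = r *\<^sub>R bop_apply T x"
  by (simp add: scaleR_scaleC bop_apply_scaleC)

lemma norm_bop_apply: "norm (bop_apply T x) \<le> norm T * norm x"
  by transfer (rule norm_blinfun)

lemma norm_bop_le:
  assumes "0 \<le> b" "\<And>x. norm (bop_apply T x) \<le> b * norm x"
  shows "norm T \<le> b"
  using assms by transfer (rule norm_blinfun_bound)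

lemma bop_of_linear:
  assumes add: "\<And>x y. f (x + y) = f x + f y" and scale: "\<And>c x. f (c *\<^sub>C x) = c *\<^sub>C f x"
    and bound: "\<And>x. norm (f x) \<le> norm x * K"
  obtains S :: "'a::chilbert_space bop" where "\<And>x. bop_apply S x = f x"
proof -
  have bl: "bounded_linear f"
    by (rule bounded_linear_intro[where K = K])
      (use assms in \<open>auto simp: scaleR_scaleC\<close>)
  have "bop_apply (Abs_bop (Blinfun f)) x = f x" for x
    using scale by (simp add: bop_apply.rep_eq Abs_bop_inverse bounded_linear_Blinfun_apply[OF bl])
  then show ?thesis
    using that by blast
qed

text \<open>For fixed \<open>y\<close> the Riesz vector of the real functional
  \<open>Re (cinner (bop_apply T x) y)\<close> serves as the value of the adjoint at
  \<open>y\<close>; uniqueness of that vector makes the assignment linear.\<close>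

lemma ex_adjoint: "\<exists>S. \<forall>x y. cinner (bop_apply T x) y = cinner x (bop_apply S y)"
proof -
  have "\<exists>z. \<forall>x. cinner (bop_apply T x) y = cinner x z" for y
  proof -
    have "bounded_linear (\<lambda>x. Re (cinner (bop_apply T x) y))"
    proof (rule bounded_linear_intro)
      fix x
      have "\<bar>Re (cinner (bop_apply T x) y)\<bar> \<le> norm (bop_apply T x) * norm y"
        using abs_Re_le_cmod norm_cinner_le order_trans by blast
      also have "\<dots> \<le> norm T * norm x * norm y"
        by (intro mult_right_mono norm_bop_apply) simp
      finally show "norm (Re (cinner (bop_apply T x) y)) \<le> norm x * (norm T * norm y)"
        by (simp add: mult_ac)
    qed (simp_all add: bop_apply_add bop_apply_scaleR cinner_add_left cinner_scaleR_left)
    then obtain z where z: "\<And>x. Re (cinner (bop_apply T x) y) = Re (cinner x z)"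
      using real_riesz by blast
    have "cinner (bop_apply T x) y = cinner x z" for x
    proof (rule complex_eqI)
      \<comment> \<open>Both sides are complex linear in \<open>x\<close>, so the real parts at
        \<open>\<i> *\<^sub>C x\<close> are the negated imaginary parts at \<open>x\<close>.\<close>
      show "Im (cinner (bop_apply T x) y) = Im (cinner x z)"
        using z[of "\<i> *\<^sub>C x"] by (simp add: bop_apply_scaleC cinner_scaleC_left)
    qed (rule z)
    then show ?thesis
      by blast
  qed
  then obtain f where f: "\<And>x y. cinner (bop_apply T x) y = cinner x (f y)"
    by metis
  have "norm (f y) \<le> norm y * norm T" for y
  proof -
    \<comment> \<open>Testing the adjoint relation at \<open>x = f y\<close>; one factor
      \<open>norm (f y)\<close> is cancelled at the end.\<close>
    have "(norm (f y))\<^sup>2 = Re (cinner (bop_apply T (f y)) y)"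
      by (simp add: norm_square f)
    also have "\<dots> \<le> norm (bop_apply T (f y)) * norm y"
      by (rule Re_cinner_le)
    also have "\<dots> \<le> norm T * norm (f y) * norm y"
      by (intro mult_right_mono norm_bop_apply) simp
    finally have "norm (f y) * norm (f y) \<le> norm (f y) * (norm y * norm T)"
      by (simp add: power2_eq_square mult_ac)
    then show ?thesis
      by (cases "norm (f y) = 0") (auto simp: mult_le_cancel_left)
  qed
  moreover have "f (x + y) = f x + f y" for x y
    by (rule cinner_eqI) (simp add: f[symmetric] cinner_add_right)
  moreover have "f (c *\<^sub>C x) = c *\<^sub>C f x" for c x
    by (rule cinner_eqI) (simp add: f[symmetric] cinner_scaleC_right)
  ultimately obtain S where "\<And>x. bop_apply S x = f x"
    using bop_of_linear[of f "norm T"] by metis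
  then show ?thesis
    using f by metis
qed

lemma bop_adj_eqI:
  fixes S T :: "'a::chilbert_space bop"
  assumes "\<And>x y. cinner (bop_apply T x) y = cinner x (bop_apply S y)"
  shows "T\<^sup>* = S"
  unfolding bop_adj_def
proof (rule the_equality)
  fix R
  assume "\<forall>x y. cinner (bop_apply T x) y = cinner x (bop_apply R y)"
  then have "\<And>x y. cinner x (bop_apply R y) = cinner x (bop_apply S y)"
    using assms by simp
  then show "R = S"
    using cinner_eqI bop_eqI by metis
qed (use assms in blast)

lemma cinner_adj:
  fixes T :: "'a::chilbert_space bop"
  shows "cinner (bop_apply T x) y = cinner x (bop_apply (T\<^sup>*) y)"
  using ex_adjoint[of T] bop_adj_eqI by metis

lemma cinner_adj':
  fixes T :: "'a::chilbert_space bop"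
  shows "cinner (bop_apply (T\<^sup>*) x) y = cinner x (bop_apply T y)"
  by (metis cinner_adj cinner_commute)

lemma adj_adj [simp]:
  fixes T :: "'a::chilbert_space bop"
  shows "(T\<^sup>*)\<^sup>* = T"
  by (rule bop_adj_eqI) (rule cinner_adj')

lemma adj_mult:
  fixes S T :: "'a::chilbert_space bop"
  shows "(S * T)\<^sup>* = T\<^sup>* * S\<^sup>*"
  by (rule bop_adj_eqI) (simp add: cinner_adj)

lemma adj_one [simp]:
  "1\<^sup>* = (1 :: 'a::chilbert_space bop)"
  by (rule bop_adj_eqI) simp

lemma adj_zero [simp]:
  "0\<^sup>* = (0 :: 'a::chilbert_space bop)"
  by (rule bop_adj_eqI) simp

lemma adj_add:
  fixes S T :: "'a::chilbert_space bop"
  shows "(S + T)\<^sup>* = S\<^sup>* + T\<^sup>*"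
  by (rule bop_adj_eqI) (simp add: cinner_add_left cinner_add_right cinner_adj)

lemma adj_diff:
  fixes S T :: "'a::chilbert_space bop"
  shows "(S - T)\<^sup>* = S\<^sup>* - T\<^sup>*"
  by (rule bop_adj_eqI) (simp add: cinner_diff_left cinner_diff_right cinner_adj)

lemma adj_scaleR:
  fixes T :: "'a::chilbert_space bop"
  shows "(r *\<^sub>R T)\<^sup>* = r *\<^sub>R T\<^sup>*"
  by (rule bop_adj_eqI) (simp add: cinner_scaleR_left cinner_scaleR_right cinner_adj)

section \<open>Positive operators\<close>

text \<open>On a complex space a real quadratic form forces self-adjointness, by
  polarisation.\<close>

lemma bop_positive_iff:
  fixes T :: "'a::chilbert_space bop"
  shows "bop_positive T \<longleftrightarrow> T\<^sup>* = T \<and> (\<forall>x. 0 \<le> Re (cinner (bop_apply T x) x))"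
proof (intro iffI conjI)
  assume T: "bop_positive T"
  then show "\<forall>x. 0 \<le> Re (cinner (bop_apply T x) x)"
    by (simp add: bop_positive_def complex_nonneg_Reals_iff)
  \<comment> \<open>The sesquilinear defect of self-adjointness: it vanishes on the diagonal, hence
    everywhere.\<close>
  define f where "f x y = cinner (bop_apply T x) y - cinner x (bop_apply T y)" for x y
  have diag: "f x x = 0" for x
    using T cinner_commute[of x "bop_apply T x"]
    by (auto simp: f_def bop_positive_def complex_nonneg_Reals_iff complex_eq_iff)
  have "f x y = 0" for x y
  proof -
    have "f x y + f y x = f (x + y) (x + y) - f x x - f y y"
      by (simp add: f_def bop_apply_add cinner_add_left cinner_add_right)
    then have "f x y + f y x = 0"
      by (simp add: diag)
    \<comment> \<open>Expanding at \<open>x + y\<close> shows that the defect is antisymmetric, at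
      \<open>x + \<i> *\<^sub>C y\<close> that it is symmetric.\<close>
    moreover have "- \<i> * f x y + \<i> * f y x = f (x + \<i> *\<^sub>C y) (x + \<i> *\<^sub>C y) - f x x - f y y"
      by (simp add: f_def bop_apply_add bop_apply_scaleC cinner_add_left cinner_add_right
          cinner_scaleC_left cinner_scaleC_right algebra_simps)
    then have "\<i> * (f y x - f x y) = 0"
      by (simp add: diag algebra_simps)
    ultimately show ?thesis
      by simp
  qed
  then show "T\<^sup>* = T"
    by (intro bop_adj_eqI) (simp add: f_def)
next
  assume T: "T\<^sup>* = T \<and> (\<forall>x. 0 \<le> Re (cinner (bop_apply T x) x))"
  have "Im (cinner (bop_apply T x) x) = 0" for x
  proof -
    have "cinner (bop_apply T x) x = cnj (cinner (bop_apply T x) x)"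
      by (metis T cinner_adj cinner_commute)
    from arg_cong[OF this, of Im] show ?thesis
      by simp
  qed
  then show "bop_positive T"
    using T by (simp add: bop_positive_def complex_nonneg_Reals_iff)
qed

lemma positive_adj:
  fixes T :: "'a::chilbert_space bop"
  shows "bop_positive T \<Longrightarrow> T\<^sup>* = T"
  by (simp add: bop_positive_iff)

lemma positive_Re: "bop_positive T \<Longrightarrow> 0 \<le> Re (cinner (bop_apply T x) x)"
  by (simp add: bop_positive_iff)

lemma positive_scaleR: "bop_positive T \<Longrightarrow> 0 \<le> r \<Longrightarrow> bop_positive (r *\<^sub>R T)"
  by (simp add: bop_positive_iff adj_scaleR cinner_scaleR_left)

lemma positive_add: "bop_positive S \<Longrightarrow> bop_positive T \<Longrightarrow> bop_positive (S + T)"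
  by (simp add: bop_positive_iff adj_add cinner_add_left)

lemma positive_adj_mult:
  fixes T :: "'a::chilbert_space bop"
  shows "bop_positive (T\<^sup>* * T)"
  by (simp add: bop_positive_iff adj_mult cinner_adj' cinner_self flip: norm_square)

lemma norm_adj_le:
  fixes T :: "'a::chilbert_space bop"
  shows "norm (T\<^sup>*) \<le> norm T"
proof (rule norm_bop_le)
  fix y
  let ?z = "bop_apply (T\<^sup>*) y"
  have "(norm ?z)\<^sup>2 = Re (cinner (bop_apply T ?z) y)"
    by (simp add: norm_square cinner_adj)
  also have "\<dots> \<le> norm (bop_apply T ?z) * norm y"
    by (rule Re_cinner_le)
  also have "\<dots> \<le> norm T * norm ?z * norm y"
    by (intro mult_right_mono norm_bop_apply) simp
  finally have "norm ?z * norm ?z \<le> norm ?z * (norm T * norm y)"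
    by (simp add: power2_eq_square mult_ac)
  then show "norm ?z \<le> norm T * norm y"
    by (cases "norm ?z = 0") (auto simp: mult_le_cancel_left)
qed simp

lemma Re_cinner_le_contraction:
  assumes "norm T \<le> 1"
  shows "Re (cinner (bop_apply T x) x) \<le> (norm x)\<^sup>2"
proof -
  have "norm (bop_apply T x) \<le> 1 * norm x"
    using norm_bop_apply[of T x] assms by (meson mult_right_mono norm_ge_zero order_trans)
  then have "norm (bop_apply T x) * norm x \<le> norm x * norm x"
    by (intro mult_right_mono) auto
  then show ?thesis
    using Re_cinner_le[of "bop_apply T x" x] by (simp add: power2_eq_square)
qed

lemma positive_one_minus:
  fixes T :: "'a::chilbert_space bop"
  assumes "T\<^sup>* = T" "norm T \<le> 1"
  shows "bop_positive (1 - T)"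
  using assms Re_cinner_le_contraction[OF assms(2)]
  by (simp add: bop_positive_iff adj_diff cinner_diff_left flip: norm_square)

text \<open>Positivity of \<open>T\<close> at \<open>x - T x\<close>.\<close>

lemma positive_contraction_norm:
  assumes T: "bop_positive T" "norm T \<le> 1"
  shows "(norm (bop_apply T x))\<^sup>2 \<le> Re (cinner (bop_apply T x) x)"
proof -
  let ?y = "bop_apply T x"
  have "cinner (bop_apply T ?y) x = cinner ?y ?y"
    by (metis T(1) cinner_adj positive_adj)
  then have "0 \<le> Re (cinner ?y x) - 2 * (norm ?y)\<^sup>2 + Re (cinner (bop_apply T ?y) ?y)"
    using positive_Re[OF T(1), of "x - ?y"]
    by (simp add: bop_apply_diff cinner_diff_left cinner_diff_right norm_square)
  then show ?thesis
    using Re_cinner_le_contraction[OF T(2), of ?y] by simp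
qed

text \<open>Expanding the square of \<open>norm (x - T x)\<close>, the term
  \<open>norm (T x)\<close> squared is absorbed by one of the two copies of
  \<open>cinner (T x) x\<close>. This bound lets the square root iteration start at
  \<open>1 - T / c\<close>.\<close>

lemma norm_one_minus_positive:
  assumes T: "bop_positive T" "norm T \<le> 1"
  shows "norm (1 - T) \<le> 1"
proof (rule norm_bop_le)
  fix x
  have "(norm (x - bop_apply T x))\<^sup>2 \<le> (norm x)\<^sup>2"
    using positive_contraction_norm[OF T, of x] positive_Re[OF T(1), of x]
    by (simp add: norm_diff_square Re_cinner_commute[of x])
  from power2_le_imp_le[OF this norm_ge_zero] show "norm (bop_apply (1 - T) x) \<le> 1 * norm x"
    by simp
qed simp

text \<open>After scaling \<open>T\<close> to a contraction,
  \<open>positive_contraction_norm\<close> bounds \<open>norm (T x)\<close> by the vanishing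
  form.\<close>

lemma positive_null:
  assumes T: "bop_positive T" and x: "Re (cinner (bop_apply T x) x) = 0"
  shows "bop_apply T x = 0"
proof -
  define c where "c = norm T + 1"
  have c: "0 < c"
    by (simp add: c_def add_nonneg_pos)
  let ?T = "(1 / c) *\<^sub>R T"
  have "norm ?T \<le> 1"
    using c by (simp add: c_def)
  then have "(norm (bop_apply ?T x))\<^sup>2 \<le> Re (cinner (bop_apply ?T x) x)"
    using T c by (intro positive_contraction_norm positive_scaleR) auto
  then have "norm (bop_apply ?T x) = 0"
    using x by (simp add: cinner_scaleR_left)
  then show ?thesis
    using c by simp
qed

section \<open>Square roots\<close>

instance bop :: (chilbert_space) banach
proof
  fix X :: "nat \<Rightarrow> 'a bop"
  assume X: "Cauchy X"
  have eq: "norm (blinfun_of_bop S - blinfun_of_bop T) = norm (S - T)" for S T :: "'a bop"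
    by (simp add: norm_bop.rep_eq minus_bop.rep_eq)
  have "Cauchy (\<lambda>n. blinfun_of_bop (X n))"
    using X by (simp add: Cauchy_iff eq)
  then obtain L where L: "(\<lambda>n. blinfun_of_bop (X n)) \<longlonglongrightarrow> L"
    using Cauchy_convergent convergent_def by blast
  \<comment> \<open>The limit exists as a real-linear operator; pointwise convergence transfers
    complex homogeneity to it.\<close>
  have ptw: "(\<lambda>n. bop_apply (X n) x) \<longlonglongrightarrow> L x" for x
    unfolding bop_apply.rep_eq by (intro blinfun.tendsto L tendsto_const)
  have scale: "bounded_linear (\<lambda>x::'a. c *\<^sub>C x)" for c
    by (rule bounded_linear_intro[where K = "cmod c"])
      (simp_all add: scaleC_add_right scaleC_scaleR_commute norm_scaleC)
  have "L (c *\<^sub>C x) = c *\<^sub>C L x" for c x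
  proof (rule LIMSEQ_unique)
    show "(\<lambda>n. bop_apply (X n) (c *\<^sub>C x)) \<longlonglongrightarrow> L (c *\<^sub>C x)"
      by (rule ptw)
    show "(\<lambda>n. bop_apply (X n) (c *\<^sub>C x)) \<longlonglongrightarrow> c *\<^sub>C L x"
      unfolding bop_apply_scaleC by (rule bounded_linear.tendsto[OF scale ptw])
  qed
  then have "blinfun_of_bop (Abs_bop L) = L"
    by (simp add: Abs_bop_inverse)
  then have "X \<longlonglongrightarrow> Abs_bop L"
    using L by (simp add: LIMSEQ_iff flip: eq)
  then show "convergent X"
    by (rule convergentI)
qed

text \<open>The iteration for \<open>Y = 1 - sqrt (1 - X)\<close>, a solution of \<open>Y = (X + Y\<^sup>2) / 2\<close>.\<close>

primrec sqrt_iter :: "'b::real_normed_algebra \<Rightarrow> nat \<Rightarrow> 'b" where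
  "sqrt_iter X 0 = 0"
| "sqrt_iter X (Suc n) = (1/2) *\<^sub>R (X + sqrt_iter X n * sqrt_iter X n)"

section \<open>Convergence of the square root iteration\<close>

lemma sqrt_iter_real_bounds: "0 \<le> sqrt_iter (1::real) n \<and> sqrt_iter (1::real) n \<le> 1"
proof (induction n)
  case (Suc n)
  then have "sqrt_iter (1::real) n * sqrt_iter 1 n \<le> 1 * 1"
    by (intro mult_mono) auto
  then show ?case
    by simp
qed simp

lemma sqrt_iter_real_step: "sqrt_iter (1::real) n \<le> sqrt_iter 1 (Suc n)"
proof -
  have "0 \<le> (1 - sqrt_iter (1::real) n)\<^sup>2"
    by simp
  then show ?thesis
    by (simp add: power2_eq_square algebra_simps)
qed

context
  fixes X :: "'b::{real_normed_algebra, banach}"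
  assumes X: "norm X \<le> 1"
begin

text \<open>The scalar iteration started from 1 majorises the one for any contraction, since the
  recursion has nonnegative coefficients.\<close>

lemma norm_sqrt_iter: "norm (sqrt_iter X n) \<le> sqrt_iter 1 n"
proof (induction n)
  case (Suc n)
  have "norm (X + sqrt_iter X n * sqrt_iter X n) \<le> norm X + norm (sqrt_iter X n) * norm (sqrt_iter X n)"
    by (intro norm_triangle_le add_left_mono norm_mult_ineq)
  also have "\<dots> \<le> 1 + sqrt_iter 1 n * sqrt_iter 1 n"
    using X Suc sqrt_iter_real_bounds by (intro add_mono mult_mono) auto
  finally show ?case
    by simp
qed simp

lemma norm_sqrt_iter_step:
  "norm (sqrt_iter X (Suc n) - sqrt_iter X n) \<le> sqrt_iter 1 (Suc n) - sqrt_iter 1 n"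
proof (induction n)
  case 0
  then show ?case
    using X by simp
next
  case (Suc n)
  define P Q p q where "P = sqrt_iter X (Suc n)" and "Q = sqrt_iter X n"
    and "p = sqrt_iter (1::real) (Suc n)" and "q = sqrt_iter (1::real) n"
  have le: "norm P \<le> p" "norm Q \<le> q" "norm (P - Q) \<le> p - q"
    unfolding P_def Q_def p_def q_def by (intro norm_sqrt_iter Suc.IH)+
  \<comment> \<open>This splitting of \<open>P * P - Q * Q\<close> needs no commutativity, and in
    the scalar case it is an equality matching the majorant.\<close>
  have eq: "sqrt_iter X (Suc (Suc n)) - P = (1/2) *\<^sub>R (P * (P - Q) + (P - Q) * Q)"
    unfolding P_def sqrt_iter.simps(2)[of X "Suc n"] unfolding sqrt_iter.simps(2)[of X n] Q_def
    by (simp add: algebra_simps)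
  have "norm (P * (P - Q) + (P - Q) * Q) \<le> norm P * norm (P - Q) + norm (P - Q) * norm Q"
    by (intro norm_triangle_le add_mono norm_mult_ineq)
  also have "\<dots> \<le> p * (p - q) + (p - q) * q"
    using le sqrt_iter_real_bounds[of "Suc n"] sqrt_iter_real_step[of n]
    by (intro add_mono mult_mono) (auto simp: p_def q_def simp del: sqrt_iter.simps)
  also have "\<dots> = 2 * (sqrt_iter 1 (Suc (Suc n)) - p)"
    unfolding p_def sqrt_iter.simps(2)[of _ "Suc n"] unfolding sqrt_iter.simps(2)[of _ n] q_def
    by (simp add: algebra_simps)
  finally show ?case
    unfolding eq[unfolded P_def] p_def by (simp add: P_def del: sqrt_iter.simps)
qed

lemma norm_sqrt_iter_diff:
  assumes "n \<le> m"
  shows "norm (sqrt_iter X m - sqrt_iter X n) \<le> sqrt_iter 1 m - sqrt_iter 1 n"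
  using assms
proof (induction m rule: dec_induct)
  case (step m)
  have "sqrt_iter X (Suc m) - sqrt_iter X n
      = (sqrt_iter X (Suc m) - sqrt_iter X m) + (sqrt_iter X m - sqrt_iter X n)"
    by (simp del: sqrt_iter.simps)
  then show ?case
    using norm_triangle_ineq norm_sqrt_iter_step[of m] step.IH by (smt (verit))
qed simp

text \<open>The scalar majorant is increasing and bounded, hence Cauchy, and its increments dominate
  those of the iteration.\<close>

lemma convergent_sqrt_iter: "convergent (sqrt_iter X)"
proof -
  have "incseq (sqrt_iter (1::real))"
    by (intro incseq_SucI sqrt_iter_real_step)
  then have "Cauchy (sqrt_iter (1::real))"
    using incseq_convergent[of "sqrt_iter (1::real)" 1] sqrt_iter_real_bounds LIMSEQ_imp_Cauchy by metis
  have "Cauchy (sqrt_iter X)"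
  proof (rule CauchyI)
    fix e :: real
    assume "0 < e"
    then obtain M where M: "\<forall>m\<ge>M. \<forall>n\<ge>M. norm (sqrt_iter (1::real) m - sqrt_iter 1 n) < e"
      using CauchyD[OF \<open>Cauchy (sqrt_iter (1::real))\<close>] by blast
    have "norm (sqrt_iter X m - sqrt_iter X n) < e" if "m \<ge> M" "n \<ge> M" for m n
    proof (cases "n \<le> m")
      case True
      then show ?thesis
        using norm_sqrt_iter_diff[OF True] M that by fastforce
    next
      case False
      then show ?thesis
        using norm_sqrt_iter_diff[of m n] M that by (fastforce simp: norm_minus_commute)
    qed
    then show "\<exists>M. \<forall>m\<ge>M. \<forall>n\<ge>M. norm (sqrt_iter X m - sqrt_iter X n) < e"
      by blast
  qed
  then show ?thesis
    by (rule Cauchy_convergent)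
qed

lemma sqrt_iter_LIMSEQ: "sqrt_iter X \<longlonglongrightarrow> lim (sqrt_iter X)"
  using convergent_sqrt_iter convergent_LIMSEQ_iff by blast

lemma lim_sqrt_iter_fixpoint:
  "lim (sqrt_iter X) = (1/2) *\<^sub>R (X + lim (sqrt_iter X) * lim (sqrt_iter X))"
proof (rule LIMSEQ_unique)
  show "(\<lambda>n. sqrt_iter X (Suc n)) \<longlonglongrightarrow> lim (sqrt_iter X)"
    by (rule LIMSEQ_Suc[OF sqrt_iter_LIMSEQ])
  show "(\<lambda>n. sqrt_iter X (Suc n)) \<longlonglongrightarrow> (1/2) *\<^sub>R (X + lim (sqrt_iter X) * lim (sqrt_iter X))"
    unfolding sqrt_iter.simps by (intro tendsto_intros sqrt_iter_LIMSEQ)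
qed

lemma norm_lim_sqrt_iter: "norm (lim (sqrt_iter X)) \<le> 1"
  using norm_sqrt_iter sqrt_iter_real_bounds
  by (intro LIMSEQ_le_const2[OF tendsto_norm[OF sqrt_iter_LIMSEQ]]) (meson order_trans)

end

text \<open>The relation passes to every iterate by induction and then to the limit. Two different
  operators are allowed because \<open>C\<close> intertwines the two defect operators.\<close>

lemma lim_sqrt_iter_intertwine:
  fixes X Y Z :: "'b::{real_normed_algebra, banach}"
  assumes "norm X \<le> 1" "norm Y \<le> 1" and ZX: "Z * X = Y * Z"
  shows "Z * lim (sqrt_iter X) = lim (sqrt_iter Y) * Z"
proof (rule LIMSEQ_unique)
  have "Z * sqrt_iter X n = sqrt_iter Y n * Z" for n
  proof (induction n)
    case (Suc n)
    then have "Z * (sqrt_iter X n * sqrt_iter X n) = sqrt_iter Y n * sqrt_iter Y n * Z"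
      by (metis mult.assoc)
    then show ?case
      by (simp add: distrib_left distrib_right ZX)
  qed simp
  then show "(\<lambda>n. Z * sqrt_iter X n) \<longlonglongrightarrow> lim (sqrt_iter Y) * Z"
    using assms by (simp only:) (intro tendsto_intros sqrt_iter_LIMSEQ)
  show "(\<lambda>n. Z * sqrt_iter X n) \<longlonglongrightarrow> Z * lim (sqrt_iter X)"
    using assms by (intro tendsto_intros sqrt_iter_LIMSEQ)
qed

lemma adj_lim_sqrt_iter:
  fixes X :: "'a::chilbert_space bop"
  assumes "norm X \<le> 1" and X: "X\<^sup>* = X"
  shows "(lim (sqrt_iter X))\<^sup>* = lim (sqrt_iter X)"
proof -
  let ?Y = "lim (sqrt_iter X)"
  have adj: "(sqrt_iter X n)\<^sup>* = sqrt_iter X n" for n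
    by (induction n) (simp_all add: adj_scaleR adj_add adj_mult X)
  \<comment> \<open>The iterates are self-adjoint and taking adjoints does not increase the norm, so
    they also converge to the adjoint of the limit.\<close>
  have "(\<lambda>n. sqrt_iter X n - ?Y\<^sup>*) \<longlonglongrightarrow> 0"
  proof (rule Lim_null_comparison)
    show "\<forall>\<^sub>F n in sequentially. norm (sqrt_iter X n - ?Y\<^sup>*) \<le> norm (sqrt_iter X n - ?Y)"
      using norm_adj_le[of "sqrt_iter X n - ?Y" for n] by (simp add: adj_diff adj)
    show "(\<lambda>n. norm (sqrt_iter X n - ?Y)) \<longlonglongrightarrow> 0"
      using sqrt_iter_LIMSEQ[OF assms(1)] by (simp add: LIM_zero tendsto_norm_zero)
  qed
  then have "sqrt_iter X \<longlonglongrightarrow> ?Y\<^sup>*"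
    by (rule LIM_zero_cancel)
  then show ?thesis
    using sqrt_iter_LIMSEQ[OF assms(1)] LIMSEQ_unique by blast
qed

text \<open>For positive \<open>T\<close> of norm at most \<open>c\<close> this is the root of
  \<open>T = c (1 - X)\<close> with \<open>X = 1 - T / c\<close>. The scale is a parameter so that
  two operators can share it.\<close>

definition scaled_sqrt :: "real \<Rightarrow> 'a::chilbert_space bop \<Rightarrow> 'a bop" where
  "scaled_sqrt c T = sqrt c *\<^sub>R (1 - lim (sqrt_iter (1 - (1/c) *\<^sub>R T)))"

section \<open>Existence and uniqueness of the positive square root\<close>

context
  fixes c :: real and T :: "'a::chilbert_space bop"
  assumes c: "0 < c" and T: "bop_positive T" "norm T \<le> c"
begin

lemma norm_one_minus_scaled: "norm (1 - (1/c) *\<^sub>R T) \<le> 1"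
  using c T by (intro norm_one_minus_positive positive_scaleR) (auto simp: divide_simps)

lemma scaled_sqrt_positive: "bop_positive (scaled_sqrt c T)"
  unfolding scaled_sqrt_def
proof (intro positive_scaleR positive_one_minus adj_lim_sqrt_iter norm_lim_sqrt_iter norm_one_minus_scaled)
  show "(1 - (1/c) *\<^sub>R T)\<^sup>* = 1 - (1/c) *\<^sub>R T"
    by (simp add: adj_diff adj_scaleR positive_adj[OF T(1)])
qed (use c in simp)

lemma scaled_sqrt_square: "scaled_sqrt c T * scaled_sqrt c T = T"
proof -
  define X where "X = 1 - (1/c) *\<^sub>R T"
  define Y where "Y = lim (sqrt_iter X)"
  have "norm X \<le> 1"
    unfolding X_def by (rule norm_one_minus_scaled)
  from lim_sqrt_iter_fixpoint[OF this] have "2 *\<^sub>R Y = 2 *\<^sub>R (1/2) *\<^sub>R (X + Y * Y)"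
    unfolding Y_def by (rule arg_cong)
  then have "Y + Y = X + Y * Y"
    by (simp add: scaleR_2)
  then have "(1 - Y) * (1 - Y) = 1 - X"
    by (simp add: algebra_simps)
  then show ?thesis
    using c unfolding scaled_sqrt_def X_def[symmetric] Y_def[symmetric] by (simp add: X_def)
qed

text \<open>Any positive root \<open>S\<close> commutes with \<open>T\<close>, hence with the
  constructed root \<open>R\<close>, so \<open>(S + R) * (S - R) = 0\<close>. For \<open>y\<close>
  in the range of \<open>S - R\<close> the forms of \<open>S\<close> and \<open>R\<close> add up to
  0, so both operators kill \<open>y\<close>; self-adjointness of \<open>S - R\<close> then gives
  \<open>y = 0\<close>.\<close>

lemma positive_sqrt_unique:
  assumes S: "bop_positive S" "S * S = T"
  shows "S = scaled_sqrt c T"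
proof -
  define R where "R = scaled_sqrt c T"
  have R: "bop_positive R" "R * R = T"
    unfolding R_def by (rule scaled_sqrt_positive scaled_sqrt_square)+
  have "S * (1 - (1/c) *\<^sub>R T) = (1 - (1/c) *\<^sub>R T) * S"
    unfolding S(2)[symmetric] by (simp add: algebra_simps)
  then have "S * R = R * S"
    using lim_sqrt_iter_intertwine[OF norm_one_minus_scaled norm_one_minus_scaled]
    by (simp add: R_def scaled_sqrt_def algebra_simps)
  then have zero: "(S + R) * (S - R) = 0"
    using S(2) R(2) by (simp add: algebra_simps)
  have "bop_apply (S - R) x = 0" for x
  proof -
    define y where "y = bop_apply (S - R) x"
    have "bop_apply (S + R) y = 0"
      unfolding y_def bop_apply_simps(7)[symmetric] zero by simp
    then have "Re (cinner (bop_apply S y) y) + Re (cinner (bop_apply R y) y) = 0"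
      by (metis bop_apply_simps(3) cinner_add_left cinner_zero_left plus_complex.sel(1) zero_complex.sel(1))
    then have "bop_apply S y = 0" "bop_apply R y = 0"
      using positive_Re[OF S(1), of y] positive_Re[OF R(1), of y]
      by (auto intro!: positive_null S R)
    then have "bop_apply (S - R) y = 0"
      by simp
    moreover have "(S - R)\<^sup>* = S - R"
      using S R by (simp add: adj_diff positive_adj)
    ultimately have "cinner y y = 0"
      by (metis cinner_adj cinner_zero_right y_def)
    then show ?thesis
      by (simp add: cinner_self y_def)
  qed
  then have "S - R = 0"
    by (intro bop_eqI) simp
  then show ?thesis
    by (simp add: R_def)
qed

lemma bop_sqrt_eq: "bop_sqrt T = scaled_sqrt c T"
  unfolding bop_sqrt_def
  by (rule the_equality) (simp_all add: scaled_sqrt_positive scaled_sqrt_square positive_sqrt_unique)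

end

lemma bop_sqrt_positive: "bop_positive T \<Longrightarrow> bop_positive (bop_sqrt T)"
  and bop_sqrt_square: "bop_positive T \<Longrightarrow> bop_sqrt T * bop_sqrt T = T"
proof -
  assume T: "bop_positive T"
  \<comment> \<open>The added 1 keeps the scale positive when \<open>T = 0\<close>.\<close>
  have c: "0 < norm T + 1" "norm T \<le> norm T + 1"
    by (simp_all add: add_nonneg_pos)
  show "bop_positive (bop_sqrt T)" "bop_sqrt T * bop_sqrt T = T"
    unfolding bop_sqrt_eq[OF c(1) T c(2)]
    using scaled_sqrt_positive scaled_sqrt_square c T by blast+
qed

text \<open>With \<open>S = T\<close> this yields commutation with roots; with \<open>S\<close> and
  \<open>T\<close> distinct it yields \<open>C * D = Ds * C\<close>.\<close>

lemma bop_sqrt_intertwine: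
  assumes S: "bop_positive S" and T: "bop_positive T" and Z: "Z * S = T * Z"
  shows "Z * bop_sqrt S = bop_sqrt T * Z"
proof -
  \<comment> \<open>One scale valid for both operators, so that the two limits are compared
    directly.\<close>
  define c where "c = norm S + norm T + 1"
  have c: "0 < c" "norm S \<le> c" "norm T \<le> c"
    by (simp_all add: c_def add_nonneg_pos)
  have "Z * (1 - (1/c) *\<^sub>R S) = (1 - (1/c) *\<^sub>R T) * Z"
    by (simp add: algebra_simps Z)
  then have "Z * lim (sqrt_iter (1 - (1/c) *\<^sub>R S)) = lim (sqrt_iter (1 - (1/c) *\<^sub>R T)) * Z"
    using c S T by (intro lim_sqrt_iter_intertwine norm_one_minus_scaled)
  then show ?thesis
    unfolding bop_sqrt_eq[OF c(1) S c(2)] bop_sqrt_eq[OF c(1) T c(3)]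
    by (simp add: scaled_sqrt_def algebra_simps)
qed

section \<open>Inverses\<close>

lemma bop_inv_left: "bop_invertible T \<Longrightarrow> bop_inv T * T = 1"
  and bop_inv_right: "bop_invertible T \<Longrightarrow> T * bop_inv T = 1"
proof -
  assume "bop_invertible T"
  then obtain S where S: "S * T = 1" "T * S = 1"
    by (auto simp: bop_invertible_def)
  have "bop_inv T = S"
    unfolding bop_inv_def
  proof (rule the_equality)
    show "R = S" if "R * T = 1 \<and> T * R = 1" for R
      using that S by (metis mult.assoc mult_1_left mult_1_right)
  qed (use S in blast)
  then show "bop_inv T * T = 1" "T * bop_inv T = 1"
    using S by simp_all
qed

text \<open>Substituting \<open>x = T y\<close> turns the form of the inverse at \<open>x\<close>
  into the form of \<open>T\<close> at \<open>y\<close>.\<close>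

lemma bop_inv_positive:
  assumes T: "bop_positive T" "bop_invertible T"
  shows "bop_positive (bop_inv T)"
  unfolding bop_positive_def
proof
  fix x
  let ?y = "bop_apply (bop_inv T) x"
  have x: "bop_apply T ?y = x"
    using bop_inv_right[OF T(2)] by (metis bop_apply_simps(2) bop_apply_simps(7))
  have "cinner ?y x = cinner (bop_apply T ?y) ?y"
    using cinner_adj[of T ?y ?y] positive_adj[OF T(1)] by (simp add: x)
  then show "cinner ?y x \<in> \<real>\<^sub>\<ge>\<^sub>0"
    using T(1) by (simp add: bop_positive_def)
qed

lemma bop_inv_commute:
  assumes "bop_invertible T" "Z * T = T * Z"
  shows "Z * bop_inv T = bop_inv T * Z"
  using bop_inv_left[OF assms(1)] bop_inv_right[OF assms(1)] assms(2)
  by (metis mult.assoc mult_1_left mult_1_right)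

context
  fixes T :: "'a::chilbert_space bop"
  assumes T: "bop_positive T" "bop_invertible T"
begin

lemma bop_inv_sqrt_positive: "bop_positive (bop_inv_sqrt T)"
  unfolding bop_inv_sqrt_def by (intro bop_sqrt_positive bop_inv_positive T)

lemma bop_inv_sqrt_square: "bop_inv_sqrt T * bop_inv_sqrt T = bop_inv T"
  unfolding bop_inv_sqrt_def by (intro bop_sqrt_square bop_inv_positive T)

lemma bop_inv_sqrt_commute: "Z * T = T * Z \<Longrightarrow> Z * bop_inv_sqrt T = bop_inv_sqrt T * Z"
  unfolding bop_inv_sqrt_def by (intro bop_sqrt_intertwine bop_inv_positive bop_inv_commute T)

end

section \<open>The dilation\<close>

lemma norm_ell2_cons: "(norm (ell2_cons h k))\<^sup>2 = (norm h)\<^sup>2 + (norm k)\<^sup>2"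
proof -
  have sq: "(norm x)\<^sup>2 = (\<Sum>n. (norm (ell2_nth x n))\<^sup>2)" for x :: "'a ell2"
    by (simp add: norm_ell2.rep_eq suminf_nonneg[OF summable_ell2])
  show ?thesis
    unfolding sq using suminf_split_head[OF summable_ell2[of "ell2_cons h k"]]
    by (simp add: ell2_cons.rep_eq)
qed

lemma ell2_cons_add: "ell2_cons (h + h') (k + k') = ell2_cons h k + ell2_cons h' k'"
  by (rule ell2_eqI) (simp add: ell2_cons.rep_eq plus_ell2.rep_eq split: nat.split)

lemma ell2_cons_scaleC: "ell2_cons (c *\<^sub>C h) (c *\<^sub>C k) = c *\<^sub>C ell2_cons h k"
  by (rule ell2_eqI) (simp add: ell2_cons.rep_eq scaleC_ell2.rep_eq split: nat.split)

lemma norm_Pair_square: "(norm (a, b))\<^sup>2 = (norm a)\<^sup>2 + (norm b)\<^sup>2"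
  by (simp add: norm_prod_def)

lemma is_isometry_first_summand: "is_isometry first_summand"
  by (auto simp: is_isometry_def clinear_map_def first_summand_def scaleC_prod_def scaleC_zero_right
      norm_prod_def)

lemma orth_proj_first_summand: "orth_proj (range first_summand) x = first_summand (fst (fst x))"
  unfolding orth_proj_def
proof (rule the_equality)
  let ?p = "first_summand (fst (fst x))"
  show "?p \<in> range first_summand \<and> (\<forall>m\<in>range first_summand. cinner (x - ?p) m = 0)"
    by (auto simp: first_summand_def cinner_prod_def)
  fix q
  assume q: "q \<in> range first_summand \<and> (\<forall>m\<in>range first_summand. cinner (x - q) m = 0)"
  then obtain h where h: "q = first_summand h"
    by blast
  have "cinner (fst (fst x) - h) g = 0" for g
    using q[THEN conjunct2, rule_format, of "first_summand g"]
    by (simp add: h first_summand_def cinner_prod_def)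
  then have "fst (fst x) - h = 0"
    by (metis cinner_self norm_eq_zero of_real_eq_0_iff power_eq_0_iff)
  then show "q = ?p"
    by (simp add: h)
qed

theorem theorem5p3:
  fixes A B C D Ds T :: "'a::chilbert_space bop"
    and V :: "'a dilation_space \<Rightarrow> 'a dilation_space"
  assumes "A * C = C * A"
    and "bop_positive A" and "bop_invertible A"
    and "norm C \<le> 1"
    and "bop_invertible (1 + A * (A - 2 *\<^sub>R 1) * C\<^sup>* * C)"
    and "B = bop_inv_sqrt (1 + A * (A - 2 *\<^sub>R 1) * C\<^sup>* * C)"
    and "D = bop_sqrt (1 - C\<^sup>* * C)"
    and "Ds = bop_sqrt (1 - C * C\<^sup>*)"
    and "T = A * B * D * C"
    and "V = (\<lambda>((h1, h2, h3), k).
               (((B * D * C) h1 + (B * D * Ds) h2,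
                 ((A - 1) * C * B * C) h1 + ((A - 1) * C * B * Ds) h2,
                 D h1 - (C\<^sup>*) h2),
                ell2_cons h3 k))"
  shows "isometric_dilation first_summand V
           (\<lambda>n. if n = 0 then 1 else bop_inv_sqrt A * T ^ n * bop_inv_sqrt A)"
proof -
  define N where "N = C\<^sup>* * C"
  define M where "M = 1 + A * (A - 2 *\<^sub>R 1) * C\<^sup>* * C"
  define Q where "Q = bop_inv_sqrt A"
  note AC = assms(1) and T = assms(9)

  \<comment> \<open>Positivity and commutation relations\<close>
  have adjA: "A\<^sup>* = A"
    by (rule positive_adj) fact
  have ACs: "A * C\<^sup>* = C\<^sup>* * A"
    using arg_cong[OF AC, of bop_adj] by (simp add: adj_mult adjA)
  have AN: "A * N = N * A"
    unfolding N_def by (metis AC ACs mult.assoc)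
  have contr: "norm (S * R) \<le> 1" if "norm S \<le> 1" "norm R \<le> 1" for S R :: "'a bop"
    using that norm_mult_ineq[of S R] mult_mono[OF that] by simp
  have nCs: "norm (C\<^sup>*) \<le> 1"
    using norm_adj_le[of C] assms(4) by simp
  have posN: "bop_positive (1 - N)"
    unfolding N_def by (intro positive_one_minus contr assms(4) nCs) (simp add: adj_mult)
  have posNs: "bop_positive (1 - C * C\<^sup>*)"
    by (intro positive_one_minus contr assms(4) nCs) (simp add: adj_mult)
  have M_mult: "M = 1 + A * (A - 2 *\<^sub>R 1) * N"
    by (simp add: M_def N_def mult.assoc)
  \<comment> \<open>This form shows that \<open>M\<close> is positive, so that \<open>B\<close> is a
    genuine root of its inverse; its two summands correspond to the first two coordinates of
    \<open>V\<close>.\<close>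
  have M_eq: "M = (1 - N) + ((A - 1) * C)\<^sup>* * ((A - 1) * C)"
  proof -
    have "((A - 1) * C)\<^sup>* * ((A - 1) * C) = C\<^sup>* * ((A - 1) * (A - 1)) * C"
      by (simp add: adj_mult adj_diff adjA mult.assoc)
    also have "C\<^sup>* * ((A - 1) * (A - 1)) = (A - 1) * (A - 1) * C\<^sup>*"
    proof -
      have "C\<^sup>* * (A - 1) = (A - 1) * C\<^sup>*"
        by (simp add: algebra_simps ACs)
      then show ?thesis
        by (metis mult.assoc)
    qed
    finally show ?thesis
      by (simp add: M_mult N_def algebra_simps scaleR_2)
  qed
  have posM: "bop_positive M"
    unfolding M_eq by (intro positive_add posN positive_adj_mult)
  have invM: "bop_invertible M"
    unfolding M_def by fact
  have B: "B = bop_inv_sqrt M" and D: "D = bop_sqrt (1 - N)"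
    unfolding M_def N_def by fact+
  define K where "K = A * (A - 2 *\<^sub>R 1)"
  have NK: "N * K = K * N" and AK: "A * K = K * A"
    by (simp_all add: K_def right_diff_distrib left_diff_distrib mult.assoc)
      (metis AN mult.assoc)
  have NM: "N * M = M * N"
    by (simp add: M_mult distrib_left distrib_right NK flip: K_def mult.assoc)
  have "A * (K * N) = K * N * A"
    by (simp add: mult.assoc flip: AN) (simp add: AK flip: mult.assoc)
  then have AM: "A * M = M * A"
    by (simp add: M_mult distrib_left distrib_right flip: K_def)
  have AB: "A * B = B * A"
    unfolding B by (intro bop_inv_sqrt_commute posM invM AM)
  have AD: "A * D = D * A"
    unfolding D by (intro bop_sqrt_intertwine posN) (simp add: algebra_simps AN)
  have "M * D = D * M"
    unfolding D by (intro bop_sqrt_intertwine posN) (simp add: algebra_simps NM)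
  then have DB: "D * B = B * D"
    unfolding B by (intro bop_inv_sqrt_commute posM invM) simp
  \<comment> \<open>\<open>C\<close> intertwines \<open>1 - C\<^sup>* * C\<close> with
    \<open>1 - C * C\<^sup>*\<close>, hence also their roots.\<close>
  have CD: "C * D = Ds * C"
    unfolding D assms(8) by (intro bop_sqrt_intertwine posN posNs) (simp add: N_def algebra_simps)
  have adj: "B\<^sup>* = B" "D\<^sup>* = D" "Ds\<^sup>* = Ds"
    unfolding B D assms(8)
    by (intro positive_adj bop_inv_sqrt_positive bop_sqrt_positive posM invM posN posNs)+
  have DD: "D * D = 1 - N" and DsDs: "Ds * Ds = 1 - C * C\<^sup>*"
    unfolding D assms(8) by (intro bop_sqrt_square posN posNs)+
  have BMB: "B * M * B = 1"
  proof -
    have "M * B = B * M"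
      unfolding B by (intro bop_inv_sqrt_commute posM invM) simp
    then have "B * M * B = B * B * M"
      by (simp add: mult.assoc)
    then show ?thesis
      unfolding B by (simp add: bop_inv_sqrt_square posM invM bop_inv_left)
  qed

  \<comment> \<open>The operator \<open>V\<close> is an isometry\<close>
  have normR: "(norm (bop_apply R x))\<^sup>2 = Re (cinner (bop_apply (R\<^sup>* * R) x) x)" for R :: "'a bop" and x
    by (simp add: norm_square cinner_adj')
  have part1: "(norm ((B * D) u))\<^sup>2 + (norm (((A - 1) * C * B) u))\<^sup>2 = (norm u)\<^sup>2" for u
  proof -
    \<comment> \<open>Since \<open>B\<close> and \<open>D\<close> commute,
      \<open>D * B * B * D\<close> can be rearranged to enclose \<open>D * D\<close> between two
      copies of \<open>B\<close>.\<close>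
    have "(B * D)\<^sup>* * (B * D) = B * (1 - N) * B"
      by (simp add: adj_mult adj flip: DD) (metis DB mult.assoc)
    moreover have "((A - 1) * C * B)\<^sup>* * ((A - 1) * C * B) = B * (((A - 1) * C)\<^sup>* * ((A - 1) * C)) * B"
      unfolding adj_mult[of "(A - 1) * C" B] adj by (simp add: mult.assoc)
    ultimately have "(B * D)\<^sup>* * (B * D) + ((A - 1) * C * B)\<^sup>* * ((A - 1) * C * B) = B * M * B"
      unfolding M_eq by (simp only: distrib_left distrib_right)
    then have "(B * D)\<^sup>* * (B * D) + ((A - 1) * C * B)\<^sup>* * ((A - 1) * C * B) = 1"
      by (simp only: BMB)
    then show ?thesis
      unfolding normR by (metis bop_apply_simps(2,3) cinner_add_left norm_square plus_complex.sel(1))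
  qed
  have part2: "(norm (C h1 + Ds h2))\<^sup>2 + (norm (D h1 - (C\<^sup>*) h2))\<^sup>2 = (norm h1)\<^sup>2 + (norm h2)\<^sup>2"
    for h1 h2
  proof -
    \<comment> \<open>Moving \<open>Ds\<close> across and using \<open>Ds * C = C * D\<close>; the
      cross terms of the two squared norms then cancel.\<close>
    have cross: "cinner (C h1) (Ds h2) = cinner (D h1) ((C\<^sup>*) h2)"
      by (metis CD adj(3) adj_adj bop_apply_simps(7) cinner_adj)
    have "(norm (C h1))\<^sup>2 + (norm (D h1))\<^sup>2 = (norm h1)\<^sup>2"
      unfolding normR adj DD by (simp add: N_def cinner_diff_left norm_square)
    moreover have "(norm (Ds h2))\<^sup>2 + (norm ((C\<^sup>*) h2))\<^sup>2 = (norm h2)\<^sup>2"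
      unfolding normR adj DsDs adj_adj by (simp add: cinner_diff_left norm_square)
    ultimately show ?thesis
      by (simp add: norm_add_square norm_diff_square cross)
  qed
  have V: "V ((h1, h2, h3), k) = (((B * D) (C h1 + Ds h2), ((A - 1) * C * B) (C h1 + Ds h2),
      D h1 - (C\<^sup>*) h2), ell2_cons h3 k)" for h1 h2 h3 k
    unfolding assms(10) by (simp add: bop_apply_add)
  have "(norm (V x))\<^sup>2 = (norm x)\<^sup>2" for x
  proof -
    obtain h1 h2 h3 k where x: "x = ((h1, h2, h3), k)"
      by (metis prod.exhaust)
    show ?thesis
      unfolding x V norm_Pair_square norm_ell2_cons using part1[of "C h1 + Ds h2"] part2[of h1 h2]
      by linarith
  qed
  then have "norm (V x) = norm x" for x
    by (simp add: power2_eq_iff_nonneg)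
  moreover have "clinear_map V"
    unfolding clinear_map_def
  proof (intro conjI allI)
    fix x y :: "'a dilation_space" and c
    obtain h1 h2 h3 k where x: "x = ((h1, h2, h3), k)"
      by (metis prod.exhaust)
    obtain h1' h2' h3' k' where y: "y = ((h1', h2', h3'), k')"
      by (metis prod.exhaust)
    show "V (x + y) = V x + V y"
      unfolding x y add_Pair V by (simp add: bop_apply_add ell2_cons_add algebra_simps)
    show "V (c *\<^sub>C x) = c *\<^sub>C V x"
      unfolding x scaleC_prod_def V fst_conv snd_conv
      by (simp add: V bop_apply_add bop_apply_scaleC ell2_cons_scaleC scaleC_add_right scaleC_diff_right)
  qed
  ultimately have isoV: "is_isometry V"
    by (simp add: is_isometry_def)

  \<comment> \<open>Compressions of the powers of \<open>V\<close>\<close>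
  have key: "C * (B * D * C) + Ds * ((A - 1) * C * B * C) = C * T"
  proof -
    \<comment> \<open>Bringing \<open>C\<close> next to \<open>Ds\<close> allows
      \<open>Ds * C = C * D\<close>; the summand with \<open>-1\<close> then cancels
      \<open>C * (B * D * C)\<close>, leaving \<open>A\<close>.\<close>
    have "Ds * ((A - 1) * C * B * C) = Ds * (C * (A - 1) * B * C)"
      by (simp add: algebra_simps AC)
    also have "\<dots> = C * (D * (A - 1) * B * C)"
      by (metis CD mult.assoc)
    also have "D * (A - 1) * B = (A - 1) * B * D"
    proof -
      have "D * (A - 1) = (A - 1) * D"
        by (simp add: algebra_simps AD)
      then show ?thesis
        by (simp add: mult.assoc DB)
    qed
    finally show ?thesis
      by (simp add: T algebra_simps)
  qed
  \<comment> \<open>The exponents differ by one: the starting vector lacks this form, which appears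
    after one application of \<open>V\<close>. The coordinates \<open>r\<close> and \<open>k\<close>
    never feed back into the first two.\<close>
  have orbit: "\<exists>r k. (V ^^ Suc n) (first_summand h)
      = (((B * D * C) ((T ^ n) h), ((A - 1) * C * B * C) ((T ^ n) h), r), k)" for n h
  proof (induction n)
    case 0
    show ?case
      by (simp add: first_summand_def V)
  next
    case (Suc n)
    let ?y = "(T ^ n) h"
    have "C ((B * D * C) ?y) + Ds (((A - 1) * C * B * C) ?y) = C (T ?y)"
      using arg_cong[OF key, of "\<lambda>S. bop_apply S ?y"] by simp
    moreover obtain r k where "(V ^^ Suc n) (first_summand h)
        = (((B * D * C) ?y, ((A - 1) * C * B * C) ?y, r), k)"
      using Suc.IH by blast
    ultimately show ?case
      unfolding funpow.simps(2)[of "Suc n"] comp_def by (simp add: V)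
  qed
  have QT: "T * Q = Q * T"
    unfolding Q_def
  proof (intro bop_inv_sqrt_commute assms(2,3))
    have "B * D * C * A = B * (D * A) * C"
      by (simp add: mult.assoc AC)
    also have "\<dots> = B * A * D * C"
      by (simp add: mult.assoc flip: AD)
    also have "\<dots> = A * (B * D * C)"
      by (simp add: mult.assoc flip: AB)
    finally show "T * A = A * T"
      by (simp add: T mult.assoc)
  qed
  \<comment> \<open>\<open>Q\<close> commutes with \<open>T\<close>, so both copies meet as
    \<open>Q * Q\<close>, the inverse of \<open>A\<close>, which cancels the leading
    \<open>A\<close> of one factor \<open>T\<close>.\<close>
  have powers: "Q * T ^ Suc n * Q = B * D * C * T ^ n" for n
  proof -
    have "T ^ m * Q = Q * T ^ m" for m
      by (induction m) (simp_all add: mult.assoc QT, metis QT mult.assoc)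
    then have "Q * T ^ Suc n * Q = Q * Q * T ^ Suc n"
      by (simp only: mult.assoc)
    also have "\<dots> = Q * Q * T * T ^ n"
      by (simp add: mult.assoc)
    also have "Q * Q * T = bop_inv A * A * (B * D * C)"
      by (simp add: Q_def bop_inv_sqrt_square assms(2,3) T mult.assoc)
    finally show ?thesis
      by (simp add: bop_inv_left assms(3))
  qed
  have "first_summand (bop_apply (if n = 0 then 1 else Q * T ^ n * Q) h)
      = orth_proj (range first_summand) ((V ^^ n) (first_summand h))" for n h
  proof (cases n)
    \<comment> \<open>This case is separate because the term is 1, whereas
      \<open>Q * T ^ 0 * Q\<close> would be the inverse of \<open>A\<close>.\<close>
    case 0
    then show ?thesis
      by (simp add: orth_proj_first_summand) (simp add: first_summand_def)
  next
    case (Suc m)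
    obtain r k where "(V ^^ n) (first_summand h)
        = (((B * D * C) ((T ^ m) h), ((A - 1) * C * B * C) ((T ^ m) h), r), k)"
      using orbit[of m h] Suc by blast
    moreover have "(Q * T ^ n * Q) h = (B * D * C) ((T ^ m) h)"
      by (simp only: Suc powers bop_apply_simps(7))
    ultimately show ?thesis
      using Suc by (simp add: orth_proj_first_summand)
  qed
  then show ?thesis
    using isoV is_isometry_first_summand unfolding isometric_dilation_def Q_def by blast
qed

end
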